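(* Let $N\in\{22,26,28,29,30,33,35,39,40,41,46,48,50\}$ and let $f_N\in\mathbb{Z}[x]$ be the polynomial listed in the context. Let $x_0\in\mathbb{Q}$ be such that $f_N(x_0)$ is not a square in $\mathbb{Q}$ and such that the (non-exceptional) quadratic point $(x_0,\sqrt{f_N(x_0)})$ on the model $y^2=f_N(x)$ of $X_0(N)$ is non-cuspidal. Let $D$ be the squarefree integer with $f_N(x_0)\in D\cdot(\mathbb{Q}^\times)^2$ and let $K=\mathbb{Q}(\sqrt{D})$. Then: - $N=22$: $D\equiv 1,2,6 \pmod 8$ (in particular $2$ is not inert in $K$). - $N=26$: $13$ is not inert in $K$, and $D$ is odd. - $N=28$: $7$ is not inert in $K$, $3$ splits in $K$, and $D>0$. - $N=29$: $29$ is not inert in $K$, and $D$ is odd. - $N=30$: $2$ and $3$ split in $K$, $D\equiv 0,1\pmod 5$ (in particular $5$ is not inert in $K$), and $D$ is odd. - $N=33$: $2$ splits in $K$, $11$ is not inert in $K$, and $D$ is odd and $D>0$. - $N=35$: $D\equiv 0,1\pmod 5$ (in particular $5$ is not inert in $K$), $2$ is unramified in $K$, $7$ splits in $K$, and $D$ is odd. - $N=39$: $3$ is not inert in $K$, $2$ is unramified in $K$, $13$ splits in $K$, and $D$ is odd. - $N=40$: $2,3,5$ split in $K$, and $D$ is odd and $D>0$. - $N=41$: $41$ is not inert in $K$. - $N=46$: $2$ splits in $K$, and $D$ is odd. - $N=48$: $2,3,5$ split in $K$, and $D$ is odd and $D>0$. - $N=50$: $5$ is not inert in $K$, and $D$ is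 odd.
   Context: For each $N$ the modular curve $X_0(N)$ is given by the hyperelliptic model $y^2=f_N(x)$ with: $f_{22}=x^6-4x^4+20x^3-40x^2+48x-32$; $f_{26}=x^6-8x^5+8x^4-18x^3+8x^2-8x+1$; $f_{28}=4x^6-12x^5+25x^4-30x^3+25x^2-12x+4$; $f_{29}=x^6-4x^5-12x^4+2x^3+8x^2+8x-7$; $f_{30}=x^8+14x^7+79x^6+242x^5+441x^4+484x^3+316x^2+112x+16$; $f_{33}=x^8+10x^6-8x^5+47x^4-40x^3+82x^2-44x+33$; $f_{35}=x^8-4x^7-6x^6-4x^5-9x^4+4x^3-6x^2+4x+1$; $f_{39}=x^8-6x^7+3x^6+12x^5-23x^4+12x^3+3x^2-6x+1$; $f_{40}=x^8+8x^6-2x^4+8x^2+1$; $f_{41}=x^8-4x^7-8x^6+10x^5+20x^4+8x^3-15x^2-20x-8$; $f_{46}=x^{12}-2x^{11}+5x^{10}+6x^9-26x^8+84x^7-113x^6+134x^5-64x^4+26x^3+12x^2+8x-7$; $f_{48}=x^8+14x^4+1$; $f_{50}=x^6-4x^5-10x^3-4x+1$. A quadratic point on such a curve is called non-exceptional if it is of the form $(x_0,\sqrt{f_N(x_0)})$ with $x_0\in\mathbb{Q}$; such a point is defined over $\mathbb{Q}(\sqrt{f_N(x_0)})$. "Non-cuspidal" means the point is not a cusp of $X_0(N)$. *)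

theory Defs
  imports
    "HOL-Complex_Analysis.Complex_Analysis"
    "HOL-Computational_Algebra.Computational_Algebra"
    "HOL-Algebra.Ideal_Product"
    "HOL-Number_Theory.Cong"
begin

section \<open>The hyperelliptic models\<close>

definition fN :: "nat \<Rightarrow> int poly" where
  "fN N = (let x = [:0, 1:] in
      if N = 22 then x^6 - 4 * x^4 + 20 * x^3 - 40 * x^2 + 48 * x - 32
      else if N = 26 then x^6 - 8 * x^5 + 8 * x^4 - 18 * x^3 + 8 * x^2 - 8 * x + 1
      else if N = 28 then 4 * x^6 - 12 * x^5 + 25 * x^4 - 30 * x^3 + 25 * x^2 - 12 * x + 4
      else if N = 29 then x^6 - 4 * x^5 - 12 * x^4 + 2 * x^3 + 8 * x^2 + 8 * x - 7
      else if N = 30 then x^8 + 14 * x^7 + 79 * x^6 + 242 * x^5 + 441 * x^4 + 484 * x^3 + 316 * x^2 + 112 * x + 16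
      else if N = 33 then x^8 + 10 * x^6 - 8 * x^5 + 47 * x^4 - 40 * x^3 + 82 * x^2 - 44 * x + 33
      else if N = 35 then x^8 - 4 * x^7 - 6 * x^6 - 4 * x^5 - 9 * x^4 + 4 * x^3 - 6 * x^2 + 4 * x + 1
      else if N = 39 then x^8 - 6 * x^7 + 3 * x^6 + 12 * x^5 - 23 * x^4 + 12 * x^3 + 3 * x^2 - 6 * x + 1
      else if N = 40 then x^8 + 8 * x^6 - 2 * x^4 + 8 * x^2 + 1
      else if N = 41 then x^8 - 4 * x^7 - 8 * x^6 + 10 * x^5 + 20 * x^4 + 8 * x^3 - 15 * x^2 - 20 * x - 8
      else if N = 46 then x^12 - 2 * x^11 + 5 * x^10 + 6 * x^9 - 26 * x^8 + 84 * x^7 - 113 * x^6 + 134 * x^5 - 64 * x^4 + 26 * x^3 + 12 * x^2 + 8 * x - 7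
      else if N = 48 then x^8 + 14 * x^4 + 1
      else if N = 50 then x^6 - 4 * x^5 - 10 * x^3 - 4 * x + 1
      else 0)"

abbreviation fN_eval :: "nat \<Rightarrow> 'a :: {comm_ring_1} \<Rightarrow> 'a" where
  "fN_eval N x \<equiv> poly (map_poly of_int (fN N)) x"


section \<open>The identification of the model with the modular curve, and its cusps\<close>

definition upper_half_plane :: "complex set" where
  "upper_half_plane = {\<tau>. Im \<tau> > 0}"

definition SL2Z :: "(int \<times> int \<times> int \<times> int) set" where
  "SL2Z = {(a, b, c, d). a * d - b * c = 1}"

definition Gamma0 :: "nat \<Rightarrow> (int \<times> int \<times> int \<times> int) set" where
  "Gamma0 N = {(a, b, c, d) \<in> SL2Z. int N dvd c}"

fun moebius_act :: "int \<times> int \<times> int \<times> int \<Rightarrow> complex \<Rightarrow> complex" where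
  "moebius_act (a, b, c, d) \<tau> = (of_int a * \<tau> + of_int b) / (of_int c * \<tau> + of_int d)"

text \<open>
  The last clause is meromorphy at every cusp: as a function of a local parameter
  \<open>exp (2 * pi * \<i> * \<tau> / h)\<close>, the function grows at most like a power of that parameter.
\<close>

definition modular_function :: "nat \<Rightarrow> (complex \<Rightarrow> complex) \<Rightarrow> bool" where
  "modular_function N g \<longleftrightarrow>
     g nicely_meromorphic_on upper_half_plane \<and>
     (\<forall>\<gamma>\<in>Gamma0 N. \<forall>\<tau>\<in>upper_half_plane. g (moebius_act \<gamma> \<tau>) = g \<tau>) \<and>
     (\<forall>\<gamma>\<in>SL2Z. \<exists>B>0. \<exists>C. \<forall>\<tau>. Im \<tau> > B \<longrightarrow>
        norm (g (moebius_act \<gamma> \<tau>)) \<le> exp (C * Im \<tau>))"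

definition rational_q_expansion :: "(complex \<Rightarrow> complex) \<Rightarrow> bool" where
  "rational_q_expansion g \<longleftrightarrow>
     (\<exists>(a :: nat \<Rightarrow> rat) (m :: nat). \<exists>B>0. \<forall>\<tau>. Im \<tau> > B \<longrightarrow>
        (\<lambda>n. of_rat (a n) * exp (2 * of_real pi * \<i> * \<tau>) ^ n)
          sums (exp (2 * of_real pi * \<i> * \<tau>) ^ m * g \<tau>))"

text \<open>
  \<open>X\<close> and \<open>Y\<close> are the coordinate functions of an isomorphism over the rationals from the
  modular curve \<open>X\<^sub>0(N)\<close> onto the smooth projective curve with affine equation
  \<open>y^2 = f\<^sub>N(x)\<close>. The rational functions on \<open>X\<^sub>0(N)\<close> over the
  rationals are the modular functions for \<open>\<Gamma>\<^sub>0(N)\<close> with rational Fourier coefficients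
  at infinity; the last clause says that the map to the curve has degree one. Points with a
  pole of \<open>X\<close> lie over infinity on the model.
\<close>

definition X0_model :: "nat \<Rightarrow> (complex \<Rightarrow> complex) \<Rightarrow> (complex \<Rightarrow> complex) \<Rightarrow> bool" where
  "X0_model N X Y \<longleftrightarrow>
     modular_function N X \<and> modular_function N Y \<and>
     rational_q_expansion X \<and> rational_q_expansion Y \<and>
     (\<forall>\<tau>\<in>upper_half_plane. \<not> is_pole X \<tau> \<longrightarrow> (Y \<tau>)\<^sup>2 = fN_eval N (X \<tau>)) \<and>
     (\<forall>\<tau>\<in>upper_half_plane. \<forall>\<sigma>\<in>upper_half_plane.
        \<not> is_pole X \<tau> \<longrightarrow> \<not> is_pole X \<sigma> \<longrightarrow> X \<tau> = X \<sigma> \<longrightarrow> Y \<tau> = Y \<sigma> \<longrightarrow>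
        (\<exists>\<gamma>\<in>Gamma0 N. \<sigma> = moebius_act \<gamma> \<tau>))"

text \<open>
  The cusps are the points \<open>\<gamma>(\<infinity>)\<close> with \<open>\<gamma> \<in> SL\<^sub>2(\<int>)\<close>; the coordinates
  of such a point on the model are limits of \<open>X\<close> and \<open>Y\<close>.
\<close>

definition is_cusp :: "(complex \<Rightarrow> complex) \<Rightarrow> (complex \<Rightarrow> complex) \<Rightarrow> complex \<times> complex \<Rightarrow> bool" where
  "is_cusp X Y P \<longleftrightarrow>
     (\<exists>\<gamma>\<in>SL2Z. ((\<lambda>\<tau>. (X (moebius_act \<gamma> \<tau>), Y (moebius_act \<gamma> \<tau>))) \<longlongrightarrow> P)
        (filtercomap Im at_top))"


section \<open>Decomposition of rational primes in quadratic fields\<close>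

definition quadratic_field :: "int \<Rightarrow> complex set" where
  "quadratic_field D = {of_rat a + of_rat b * csqrt (of_int D) | a b. True}"

definition ring_of_integers :: "complex set \<Rightarrow> complex ring" where
  "ring_of_integers K =
     \<lparr>carrier = {z \<in> K. algebraic_int z}, mult = (*), one = 1, zero = 0, add = (+)\<rparr>"

text \<open>
  In the next three definitions \<open>p\<close> is a rational prime and \<open>K\<close> a quadratic field,
  so that \<open>p\<close> generates a prime ideal, a product of two distinct prime ideals or the
  square of a prime ideal.
\<close>

definition inert_in :: "nat \<Rightarrow> complex set \<Rightarrow> bool" where
  "inert_in p K \<longleftrightarrow>
     (let R = ring_of_integers K in primeideal (PIdl\<^bsub>R\<^esub> (of_nat p)) R)"

definition splits_in :: "nat \<Rightarrow> complex set \<Rightarrow> bool" where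
  "splits_in p K \<longleftrightarrow>
     (let R = ring_of_integers K in
        \<exists>P Q. primeideal P R \<and> primeideal Q R \<and> P \<noteq> Q \<and> PIdl\<^bsub>R\<^esub> (of_nat p) = P \<cdot>\<^bsub>R\<^esub> Q)"

definition ramified_in :: "nat \<Rightarrow> complex set \<Rightarrow> bool" where
  "ramified_in p K \<longleftrightarrow>
     (let R = ring_of_integers K in
        \<exists>P. primeideal P R \<and> PIdl\<^bsub>R\<^esub> (of_nat p) = P \<cdot>\<^bsub>R\<^esub> P)"

end

theory Submission
  imports Defs "HOL-Number_Theory.Quadratic_Reciprocity"
begin

text \<open>
  With \<open>x\<^sub>0 = a / b\<close> in lowest terms, homogenization turns \<open>f\<^sub>N(x\<^sub>0) = D r\<^sup>2\<close> into
  \<open>F(a, b) = D s\<^sup>2\<close> with an integer \<open>s\<close>. The class of \<open>D\<close> modulo squares of \<open>p\<close>-adic units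
  is then read off \<open>F(a, b)\<close>, and a finite search over residue discs of \<open>a / b\<close> shows that in
  every disc the value has odd valuation or lies in an admissible square class. The decomposition
  of \<open>p\<close> follows from the order generated by \<open>\<surd>D\<close> or \<open>(1 + \<surd>D) / 2\<close>.

  The congruence \<open>D \<equiv> 0, 1\<close> modulo \<open>5\<close> for \<open>N = 30, 35\<close> is not local at \<open>5\<close>. The irreducible
  factors of \<open>F\<close> are norms from \<open>\<rat>(\<surd>5)\<close>, so that an odd prime dividing \<open>F(a, b)\<close> is \<open>0\<close> or
  \<open>\<plusminus>1\<close> modulo \<open>5\<close> by quadratic reciprocity, while \<open>2\<close> divides \<open>s\<close> not at all or exactly twice.
  Hence \<open>s\<^sup>2 \<equiv> 1\<close> and \<open>D \<equiv> F(a, b)\<close> modulo \<open>5\<close> as soon as \<open>5\<close> does not divide \<open>s\<close>.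
\<close>

hide_const (open) Module.smult UnivPoly.coeff

section \<open>Orders generated by a quadratic integer\<close>

definition int_span :: "complex \<Rightarrow> complex set" where
  "int_span \<theta> = {of_int c + of_int d * \<theta> | c d. True}"

text \<open>When \<open>s\<close> is a root modulo \<open>p\<close> of \<open>X^2 - t X - m\<close>,
  the minimal polynomial of \<open>\<theta>\<close>, this is the kernel of the ring homomorphism to
  the integers modulo \<open>p\<close> that sends \<open>\<theta>\<close> to
  \<open>s\<close>.\<close>

definition root_ideal :: "complex \<Rightarrow> int \<Rightarrow> int \<Rightarrow> complex set" where
  "root_ideal \<theta> p s = {of_int c + of_int d * \<theta> | c d. p dvd c + d * s}"

text \<open>Common frame for the two shapes of the ring of integers: \<open>\<theta>\<close> is
  \<open>\<surd>D\<close> with \<open>t = 0\<close>, \<open>m = D\<close>, or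
  \<open>(1 + \<surd>D) / 2\<close> with \<open>t = 1\<close>,
  \<open>m = (D - 1) / 4\<close>.\<close>

locale quadratic_order =
  fixes R :: "complex ring" and \<theta> :: complex and t m :: int
  assumes R: "R = \<lparr>carrier = int_span \<theta>, mult = (*), one = 1, zero = 0, add = (+)\<rparr>"
    and theta_square: "\<theta>\<^sup>2 = of_int t * \<theta> + of_int m"
    and independent: "of_int c + of_int d * \<theta> = 0 \<Longrightarrow> c = 0 \<and> d = 0"
begin

lemma coordinates_eq_iff:
  "of_int c + of_int d * \<theta> = of_int c' + of_int d' * \<theta> \<longleftrightarrow> c = c' \<and> d = d'"
proof
  assume "of_int c + of_int d * \<theta> = of_int c' + of_int d' * \<theta>"
  then have "of_int (c - c') + of_int (d - d') * \<theta> = 0"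
    by (simp add: algebra_simps)
  then show "c = c' \<and> d = d'"
    using independent by fastforce
qed auto

lemma coordinates_add:
  "(of_int c + of_int d * \<theta>) + (of_int c' + of_int d' * \<theta>) = of_int (c + c') + of_int (d + d') * \<theta>"
  by (simp add: algebra_simps)

lemma coordinates_mult:
  "(of_int c + of_int d * \<theta>) * (of_int c' + of_int d' * \<theta>) =
     of_int (c * c' + d * d' * m) + of_int (c * d' + d * c' + d * d' * t) * \<theta>"
proof -
  have "(of_int c + of_int d * \<theta>) * (of_int c' + of_int d' * \<theta>) =
    of_int (c * c') + of_int (c * d' + d * c') * \<theta> + of_int (d * d') * \<theta>\<^sup>2"
    by (simp add: algebra_simps power2_eq_square)
  then show ?thesis
    unfolding theta_square by (simp add: algebra_simps)
qed

lemma in_int_spanI: "of_int c + of_int d * \<theta> \<in> int_span \<theta>"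
  unfolding int_span_def by blast

lemma in_int_spanE:
  assumes "z \<in> int_span \<theta>"
  obtains c d where "z = of_int c + of_int d * \<theta>"
  using assms unfolding int_span_def by blast

lemma of_int_in_int_span: "of_int c \<in> int_span \<theta>"
  using in_int_spanI[of c 0] by simp

lemma in_root_ideal_iff:
  "of_int c + of_int d * \<theta> \<in> root_ideal \<theta> p s \<longleftrightarrow> p dvd c + d * s"
  unfolding root_ideal_def using coordinates_eq_iff by auto

lemma int_span_add: "z \<in> int_span \<theta> \<Longrightarrow> w \<in> int_span \<theta> \<Longrightarrow> z + w \<in> int_span \<theta>"
  by (elim in_int_spanE) (simp only: coordinates_add in_int_spanI)

lemma int_span_mult: "z \<in> int_span \<theta> \<Longrightarrow> w \<in> int_span \<theta> \<Longrightarrow> z * w \<in> int_span \<theta>"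
  by (elim in_int_spanE) (simp only: coordinates_mult in_int_spanI)

lemma int_span_uminus: "z \<in> int_span \<theta> \<Longrightarrow> - z \<in> int_span \<theta>"
  using int_span_mult[OF of_int_in_int_span[of "-1"]] by simp

lemma cring: "cring R"
proof (rule cringI)
  show "abelian_group R"
    by (rule abelian_groupI)
      (use of_int_in_int_span[of 0] in \<open>auto simp: R int_span_add add.assoc add.commute
        intro: bexI[of _ "- x" for x] dest: int_span_uminus\<close>)
  show "comm_monoid R"
    by (rule comm_monoidI)
      (use of_int_in_int_span[of 1] in \<open>auto simp: R int_span_mult mult.assoc mult.commute\<close>)
qed (auto simp: R algebra_simps)

sublocale cring R
  by (rule cring)

lemma carrier_eq: "carrier R = int_span \<theta>"
  and mult_eq: "x \<otimes>\<^bsub>R\<^esub> y = x * y" and add_eq: "x \<oplus>\<^bsub>R\<^esub> y = x + y"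
  and one_eq: "\<one>\<^bsub>R\<^esub> = 1" and zero_eq: "\<zero>\<^bsub>R\<^esub> = 0"
  by (simp_all add: R)

section \<open>Ideals above a rational prime\<close>

lemma principal_iff:
  "of_int c + of_int d * \<theta> \<in> PIdl\<^bsub>R\<^esub> (of_int p) \<longleftrightarrow> p dvd c \<and> p dvd d"
proof
  assume "of_int c + of_int d * \<theta> \<in> PIdl\<^bsub>R\<^esub> (of_int p)"
  then obtain x where "x \<in> int_span \<theta>" "of_int c + of_int d * \<theta> = x * of_int p"
    unfolding cgenideal_def carrier_eq mult_eq by auto
  then obtain a b where "of_int c + of_int d * \<theta> = (of_int a + of_int b * \<theta>) * of_int p"
    by (metis in_int_spanE)
  also have "\<dots> = of_int (a * p) + of_int (b * p) * \<theta>"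
    by (simp add: algebra_simps)
  finally have "c = a * p \<and> d = b * p"
    by (simp only: coordinates_eq_iff)
  then show "p dvd c \<and> p dvd d"
    by simp
next
  assume "p dvd c \<and> p dvd d"
  then obtain a b where "c = p * a" "d = p * b"
    by (auto elim!: dvdE)
  then have "of_int c + of_int d * \<theta> = (of_int a + of_int b * \<theta>) * of_int p"
    by (simp add: algebra_simps)
  then show "of_int c + of_int d * \<theta> \<in> PIdl\<^bsub>R\<^esub> (of_int p)"
    unfolding cgenideal_def carrier_eq mult_eq using in_int_spanI by blast
qed

lemma principal_subset: "PIdl\<^bsub>R\<^esub> (of_int p) \<subseteq> int_span \<theta>"
  unfolding cgenideal_def carrier_eq mult_eq using int_span_mult of_int_in_int_span by auto

text \<open>Multiplicativity of \<open>\<theta> \<mapsto> s\<close> modulo \<open>p\<close>: the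
  product of the two values and the value of the product differ by \<open>d * d'\<close> times the
  minimal polynomial at \<open>s\<close>.\<close>

lemma root_ideal_mult_dvd:
  assumes "p dvd s\<^sup>2 - t * s - m"
  shows "p dvd (c + d * s) * (c' + d' * s) \<longleftrightarrow>
    p dvd (c * c' + d * d' * m) + (c * d' + d * c' + d * d' * t) * s"
proof -
  have "(c + d * s) * (c' + d' * s) =
     ((c * c' + d * d' * m) + (c * d' + d * c' + d * d' * t) * s) + d * d' * (s\<^sup>2 - t * s - m)"
    by (simp add: algebra_simps power2_eq_square)
  then show ?thesis
    using assms by (simp add: dvd_add_left_iff)
qed

lemma ideal_root_ideal:
  assumes "p dvd s\<^sup>2 - t * s - m"
  shows "ideal (root_ideal \<theta> p s) R"
proof (rule idealI)
  show "ring R"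
    by (rule ring_axioms)
  show "subgroup (root_ideal \<theta> p s) (add_monoid R)"
  proof (rule add.subgroupI)
    show "root_ideal \<theta> p s \<subseteq> carrier R"
      unfolding carrier_eq root_ideal_def int_span_def by blast
    show "root_ideal \<theta> p s \<noteq> {}"
      using in_root_ideal_iff[of 0 0 p s] by auto
    show "\<ominus>\<^bsub>R\<^esub> z \<in> root_ideal \<theta> p s" if z: "z \<in> root_ideal \<theta> p s" for z
    proof -
      obtain c d where cd: "z = of_int c + of_int d * \<theta>" "p dvd c + d * s"
        using z unfolding root_ideal_def by blast
      have "\<ominus>\<^bsub>R\<^esub> z = of_int (- c) + of_int (- d) * \<theta>"
        by (rule minus_equality)
          (use in_int_spanI[of c d] in_int_spanI[of "-c" "-d"]
            in \<open>auto simp: cd add_eq zero_eq carrier_eq\<close>)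
      moreover have "- c + - d * s = - (c + d * s)"
        by simp
      ultimately show ?thesis
        using cd(2) by (simp only: in_root_ideal_iff dvd_minus_iff)
    qed
    show "z \<oplus>\<^bsub>R\<^esub> w \<in> root_ideal \<theta> p s"
      if zw: "z \<in> root_ideal \<theta> p s" "w \<in> root_ideal \<theta> p s" for z w
    proof -
      obtain c d c' d' where cd: "z = of_int c + of_int d * \<theta>" "p dvd c + d * s"
          "w = of_int c' + of_int d' * \<theta>" "p dvd c' + d' * s"
        using zw unfolding root_ideal_def by blast
      have "p dvd (c + d * s) + (c' + d' * s)"
        using cd by (auto intro: dvd_add[of p "c + d * s" "c' + d' * s"])
      also have "(c + d * s) + (c' + d' * s) = (c + c') + (d + d') * s"
        by (simp add: algebra_simps)
      finally show ?thesis
        unfolding cd add_eq coordinates_add in_root_ideal_iff .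
    qed
  qed
  have mult: "z * w \<in> root_ideal \<theta> p s" if zw: "z \<in> root_ideal \<theta> p s" "w \<in> carrier R" for z w
  proof -
    obtain c d c' d' where cd: "z = of_int c + of_int d * \<theta>" "p dvd c + d * s"
        "w = of_int c' + of_int d' * \<theta>"
      using zw unfolding root_ideal_def carrier_eq int_span_def by blast
    then show ?thesis
      unfolding cd(1,3) coordinates_mult in_root_ideal_iff
      using root_ideal_mult_dvd[OF assms, of c d c' d'] cd(2) by (metis dvd_mult2)
  qed
  then show "z \<otimes>\<^bsub>R\<^esub> w \<in> root_ideal \<theta> p s" "w \<otimes>\<^bsub>R\<^esub> z \<in> root_ideal \<theta> p s"
    if "z \<in> root_ideal \<theta> p s" "w \<in> carrier R" for z w
    using that by (simp_all add: mult_eq mult.commute[of w])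
qed

text \<open>The quotient embeds in the field of \<open>p\<close> elements by evaluation at
  \<open>s\<close>, so it is a domain.\<close>

lemma primeideal_root_ideal:
  assumes "prime p" "p dvd s\<^sup>2 - t * s - m"
  shows "primeideal (root_ideal \<theta> p s) R"
proof (rule primeidealI[OF ideal_root_ideal[OF assms(2)] cring])
  have "of_int 1 + of_int 0 * \<theta> \<notin> root_ideal \<theta> p s"
    unfolding in_root_ideal_iff using not_prime_unit[of p] assms(1) by auto
  then show "carrier R \<noteq> root_ideal \<theta> p s"
    using in_int_spanI carrier_eq by blast
  show "z \<in> root_ideal \<theta> p s \<or> w \<in> root_ideal \<theta> p s"
    if zw: "z \<in> carrier R" "w \<in> carrier R" "z \<otimes>\<^bsub>R\<^esub> w \<in> root_ideal \<theta> p s" for z w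
  proof -
    obtain c d c' d' where cd: "z = of_int c + of_int d * \<theta>" "w = of_int c' + of_int d' * \<theta>"
      using zw unfolding carrier_eq by (metis in_int_spanE)
    then have "p dvd (c + d * s) * (c' + d' * s)"
      using zw(3) unfolding cd mult_eq coordinates_mult in_root_ideal_iff
      using root_ideal_mult_dvd[OF assms(2)] by simp
    then show ?thesis
      unfolding cd in_root_ideal_iff using assms(1) by (simp add: prime_dvd_mult_iff)
  qed
qed

text \<open>\<open>\<theta> - s\<close> and \<open>\<theta> - (t - s)\<close> multiply to minus the
  minimal polynomial at \<open>s\<close>, a multiple of \<open>p\<close>, while neither factor is
  divisible by \<open>p\<close>, its \<open>\<theta>\<close>-coordinate being 1.\<close>

lemma not_primeideal_principal:
  assumes "prime p" "p dvd s\<^sup>2 - t * s - m"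
  shows "\<not> primeideal (PIdl\<^bsub>R\<^esub> (of_int p)) R"
proof
  assume "primeideal (PIdl\<^bsub>R\<^esub> (of_int p)) R"
  then interpret primeideal "PIdl\<^bsub>R\<^esub> (of_int p)" R .
  define z w where "z = of_int (- s) + of_int 1 * \<theta>" and "w = of_int (s - t) + of_int 1 * \<theta>"
  have "z * w = of_int (- (s\<^sup>2 - t * s - m)) + of_int 0 * \<theta>"
    unfolding z_def w_def coordinates_mult coordinates_eq_iff
    by (simp add: algebra_simps power2_eq_square)
  then have "z * w \<in> PIdl\<^bsub>R\<^esub> (of_int p)"
    using assms(2) by (simp only: principal_iff dvd_minus_iff) simp
  then have "z \<in> PIdl\<^bsub>R\<^esub> (of_int p) \<or> w \<in> PIdl\<^bsub>R\<^esub> (of_int p)"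
    using I_prime[of z w] in_int_spanI unfolding z_def w_def carrier_eq mult_eq by blast
  then have "p dvd 1"
    unfolding z_def w_def principal_iff by blast
  then show False
    using assms(1) not_prime_unit by blast
qed

text \<open>The last hypothesis says that the roots \<open>s\<close> and \<open>t - s\<close> are
  distinct modulo \<open>p\<close>. Their ideals are then comaximal, so the product is the
  intersection, which is computed in coordinates.\<close>

lemma principal_eq_prod_root_ideals:
  assumes "prime p" "p dvd s\<^sup>2 - t * s - m" "\<not> p dvd 2 * s - t"
  shows "\<exists>P Q. primeideal P R \<and> primeideal Q R \<and> P \<noteq> Q \<and> PIdl\<^bsub>R\<^esub> (of_int p) = P \<cdot>\<^bsub>R\<^esub> Q"
proof (intro exI conjI)
  define P Q where "P = root_ideal \<theta> p s" and "Q = root_ideal \<theta> p (t - s)"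
  have conj: "p dvd (t - s)\<^sup>2 - t * (t - s) - m"
    using assms(2) by (simp add: algebra_simps power2_eq_square)
  show P: "primeideal P R" and Q: "primeideal Q R"
    unfolding P_def Q_def using assms conj by (auto intro: primeideal_root_ideal)
  have "of_int (- s) + of_int 1 * \<theta> \<in> P"
    unfolding P_def in_root_ideal_iff by simp
  moreover have "of_int (- s) + of_int 1 * \<theta> \<notin> Q"
    using assms(3) dvd_minus_iff[of p "2 * s - t"] unfolding Q_def in_root_ideal_iff by simp
  ultimately show "P \<noteq> Q"
    by blast
  have idl: "ideal P R" "ideal Q R"
    using P Q by (auto intro: primeideal.axioms)
  have "coprime p (2 * s - t)"
    using assms(1,3) by (simp add: prime_imp_coprime)
  then obtain u v where uv: "u * p + v * (2 * s - t) = 1"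
    using bezout_int[of p "2 * s - t"] by (metis coprime_imp_gcd_eq_1)
  \<comment> \<open>Comaximality from the Bezout relation: \<open>x\<close> is
    \<open>u * p - v * (\<theta> - s)\<close> and \<open>y\<close> is
    \<open>v * (\<theta> - (t - s))\<close>, with sum
    \<open>u * p + v * (2 * s - t)\<close>.\<close>
  define x y where "x = of_int (v * s + u * p) + of_int (- v) * \<theta>"
    and "y = of_int (v * (s - t)) + of_int v * \<theta>"
  have xy: "x \<in> P" "y \<in> Q" "x + y = 1"
  proof -
    show "x \<in> P" "y \<in> Q"
      unfolding x_def y_def P_def Q_def in_root_ideal_iff by (simp_all add: algebra_simps)
    have "x + y = of_int 1 + of_int 0 * \<theta>"
      unfolding x_def y_def coordinates_add coordinates_eq_iff using uv by (simp add: algebra_simps)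
    then show "x + y = 1"
      by simp
  qed
  have "P <+>\<^bsub>R\<^esub> Q = carrier R"
  proof (rule ideal.one_imp_carrier[OF add_ideals[OF idl]])
    show "\<one>\<^bsub>R\<^esub> \<in> P <+>\<^bsub>R\<^esub> Q"
      unfolding set_add_def set_mult_def using xy by (auto simp: one_eq add_eq R)
  qed
  then have "P \<cdot>\<^bsub>R\<^esub> Q = P \<inter> Q"
    using ideal_prod_eq_inter idl by blast
  also have "\<dots> = PIdl\<^bsub>R\<^esub> (of_int p)"
  proof (rule Set.set_eqI)
    fix z
    show "z \<in> P \<inter> Q \<longleftrightarrow> z \<in> PIdl\<^bsub>R\<^esub> (of_int p)"
    proof (cases "z \<in> int_span \<theta>")
      case False
      then show ?thesis
        using principal_subset unfolding P_def root_ideal_def int_span_def by blast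
    next
      case True
      then obtain c d where z: "z = of_int c + of_int d * \<theta>"
        by (rule in_int_spanE)
      have "p dvd c \<and> p dvd d" if "p dvd c + d * s" "p dvd c + d * (t - s)"
      proof -
        have "p dvd (c + d * s) - (c + d * (t - s))"
          using that by (rule dvd_diff)
        then have "p dvd d * (2 * s - t)"
          by (simp add: algebra_simps)
        then have "p dvd d"
          using assms by (simp add: prime_dvd_mult_iff)
        with that show ?thesis
          by (simp add: dvd_add_left_iff)
      qed
      then show ?thesis
        unfolding z P_def Q_def Int_iff in_root_ideal_iff principal_iff by auto
    qed
  qed
  finally show "PIdl\<^bsub>R\<^esub> (of_int p) = P \<cdot>\<^bsub>R\<^esub> Q" ..
qed

text \<open>When \<open>t\<close> is odd, the quotient by \<open>2\<close> is reduced: \<open>P \<cdot> P = (2)\<close> would give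
  \<open>P \<subseteq> (2)\<close> and then \<open>2 \<in> (4)\<close>.\<close>

lemma principal_2_neq_square:
  assumes "odd t" "ideal P R"
  shows "PIdl\<^bsub>R\<^esub> (of_int 2) \<noteq> P \<cdot>\<^bsub>R\<^esub> P"
proof
  assume eq: "PIdl\<^bsub>R\<^esub> (of_int 2) = P \<cdot>\<^bsub>R\<^esub> P"
  have sub: "\<exists>c d. z = of_int (2 * c) + of_int (2 * d) * \<theta>" if z: "z \<in> P" for z
  proof -
    obtain c d where cd: "z = of_int c + of_int d * \<theta>"
      using z ideal.Icarr[OF assms(2)] unfolding carrier_eq by (metis in_int_spanE)
    have "z * z \<in> PIdl\<^bsub>R\<^esub> (of_int 2)"
      using ideal_prod.prod[OF z z, of R] eq by (simp add: mult_eq)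
    then have "even (c * c + d * d * m)" "even (c * d + d * c + d * d * t)"
      unfolding cd coordinates_mult principal_iff by auto
    \<comment> \<open>The \<open>\<theta>\<close>-coordinate of the square is
      \<open>d * d * t\<close> modulo 2, so odd \<open>t\<close> forces \<open>d\<close> even; then
      the constant coordinate forces \<open>c\<close> even.\<close>
    then have "even c" "even d"
      using assms(1) by auto
    then show ?thesis
      unfolding cd by (metis evenE)
  qed
  have four: "\<exists>c d. z = of_int (4 * c) + of_int (4 * d) * \<theta>" if "z \<in> P \<cdot>\<^bsub>R\<^esub> P" for z
    using that
  proof induction
    case (prod i j)
    obtain c d c' d' where "i = of_int (2 * c) + of_int (2 * d) * \<theta>"
      "j = of_int (2 * c') + of_int (2 * d') * \<theta>"
      using sub prod by metis
    then have "i \<otimes>\<^bsub>R\<^esub> j = of_int (4 * (c * c' + d * d' * m))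
        + of_int (4 * (c * d' + d * c' + d * d' * t)) * \<theta>"
      unfolding mult_eq by (simp only: coordinates_mult) (simp add: algebra_simps)
    then show ?case
      by blast
  next
    case (sum x y)
    then obtain c d c' d' where "x = of_int (4 * c) + of_int (4 * d) * \<theta>"
      "y = of_int (4 * c') + of_int (4 * d') * \<theta>"
      by blast
    then have "x \<oplus>\<^bsub>R\<^esub> y = of_int (4 * (c + c')) + of_int (4 * (d + d')) * \<theta>"
      unfolding add_eq by (simp add: algebra_simps)
    then show ?case
      by blast
  qed
  have "of_int 2 + of_int 0 * \<theta> \<in> P \<cdot>\<^bsub>R\<^esub> P"
    unfolding eq[symmetric] principal_iff by simp
  then obtain c d where "of_int 2 + of_int 0 * \<theta> = of_int (4 * c) + of_int (4 * d) * \<theta>"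
    using four by blast
  then have "2 = 4 * c"
    unfolding coordinates_eq_iff by simp
  then show False
    by presburger
qed

end

section \<open>Rings of integers of quadratic fields\<close>

lemma map_poly_of_int_hom:
  "map_poly of_int (p + q) = map_poly of_int p + map_poly (of_int :: int \<Rightarrow> 'a :: comm_ring_1) q"
  "map_poly of_int (p * q) = map_poly of_int p * map_poly (of_int :: int \<Rightarrow> 'a :: comm_ring_1) q"
  "map_poly of_int (smult k p) = smult (of_int k) (map_poly (of_int :: int \<Rightarrow> 'a :: comm_ring_1) p)"
  by (rule poly_eqI, simp add: coeff_map_poly coeff_mult)+

text \<open>Gauss' lemma: \<open>Q\<close> divides a nonzero multiple of the monic integer polynomial annihilating \<open>z\<close>.\<close>

lemma algebraic_int_quadratic_lead_coeff_unit:
  fixes z :: complex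
  assumes "algebraic_int z" "z \<notin> \<rat>"
    and Q: "of_int a * z\<^sup>2 + of_int b * z + of_int c = 0" "a \<noteq> 0" "content [:c, b, a:] = 1"
  shows "is_unit a"
proof -
  define q where "q = [:c, b, a:]"
  have q: "degree q = 2" "lead_coeff q = a"
    using \<open>a \<noteq> 0\<close> by (simp_all add: q_def)
  have qz: "poly (map_poly of_int q) z = 0"
    using Q(1) by (simp add: q_def algebra_simps power2_eq_square map_poly_pCons)
  obtain p where p: "poly (map_poly of_int p) z = 0" "lead_coeff p = 1"
    using assms(1) algebraic_int_altdef_ipoly by blast
  \<comment> \<open>Pseudo-division stays over the integers at the price of the factor
    \<open>k\<close>, which primitivity of \<open>q\<close> removes at the end.\<close>
  define r where "r = pseudo_mod p q"
  have "q \<noteq> 0"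
    using q(1) by auto
  from pseudo_mod[OF this, of p, folded r_def] obtain k s
    where ks: "k \<noteq> 0" "smult k p = q * s + r" and deg: "r = 0 \<or> degree r < degree q"
    by blast
  have "poly (map_poly of_int (smult k p)) z = poly (map_poly of_int (q * s + r)) z"
    using ks(2) by simp
  then have rz: "poly (map_poly of_int r) z = 0"
    using p(1) qz by (simp add: map_poly_of_int_hom)
  \<comment> \<open>A nonzero polynomial of degree at most 1 cannot vanish at the irrational
    \<open>z\<close>.\<close>
  have "r = 0"
  proof (rule ccontr)
    assume "r \<noteq> 0"
    then have "degree r \<le> 1"
      using deg q(1) by simp
    then have "r = [:coeff r 0, coeff r 1:]"
      by (intro poly_eqI) (auto simp: coeff_pCons coeff_eq_0 split: nat.splits)
    then obtain u v where r: "r = [:u, v:]"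
      by blast
    have eq: "of_int v * z = - of_int u"
      using rz unfolding r by (simp add: map_poly_pCons add_eq_0_iff mult.commute)
    show False
    proof (cases "v = 0")
      case True
      then show ?thesis
        using eq \<open>r \<noteq> 0\<close> r by simp
    next
      case False
      then have "z = of_int (- u) / of_int v"
        using eq by (simp add: field_simps)
      then show ?thesis
        using assms(2) by (metis Rats_divide Rats_of_int)
    qed
  qed
  with ks have "q dvd [:k:] * p"
    by simp
  \<comment> \<open>A common divisor is constant, so it divides the content of \<open>q\<close>,
    which is 1.\<close>
  moreover have "coprime q [:k:]"
  proof (rule coprimeI)
    fix d
    assume d: "d dvd q" "d dvd [:k:]"
    have "degree d \<le> degree [:k:]"
      using d(2) ks(1) by (intro dvd_imp_degree_le) auto
    then obtain d0 where d0: "d = [:d0:]"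
      using degree_eq_zeroE by auto
    then show "is_unit d"
      using d(1) Q(3) by (simp add: const_poly_dvd_iff_dvd_content q_def is_unit_const_poly_iff)
  qed
  ultimately have "q dvd p"
    using coprime_dvd_mult_right_iff by blast
  then obtain s' where "p = q * s'"
    by (rule dvdE)
  then have "1 = a * lead_coeff s'"
    using p(2) q(2) lead_coeff_mult by metis
  then show ?thesis
    by (metis dvd_triv_left)
qed

text \<open>Clearing denominators and content turns the monic rational equation into a primitive
  integral one. Its leading coefficient is a unit, so dividing by it again creates no
  denominators.\<close>

lemma algebraic_int_quadratic_Ints:
  fixes z :: complex and u v :: rat
  assumes "algebraic_int z" "z \<notin> \<rat>" and eq: "z\<^sup>2 + of_rat u * z + of_rat v = 0"
  shows "u \<in> \<int>" "v \<in> \<int>"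
proof -
  obtain a1 a2 b1 b2 where ab: "u = of_int a1 / of_int a2" "a2 > 0" "v = of_int b1 / of_int b2" "b2 > 0"
    by (metis quotient_of_div quotient_of_denom_pos surj_pair)
  \<comment> \<open>\<open>q\<close> is \<open>a2 * b2\<close> times
    \<open>X^2 + u X + v\<close>.\<close>
  define q where "q = [:b1 * a2, a1 * b2, a2 * b2:]"
  define g where "g = content q"
  define a b c where "a = (a2 * b2) div g" and "b = (a1 * b2) div g" and "c = (b1 * a2) div g"
  have qn: "q \<noteq> 0"
    using ab by (simp add: q_def)
  then have g: "g \<noteq> 0"
    by (simp add: g_def)
  have pp: "primitive_part q = [:c, b, a:]"
    unfolding primitive_part_def
    using qn by (simp add: q_def a_def b_def c_def g_def map_poly_pCons)
  then have q: "q = smult g [:c, b, a:]"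
    using content_times_primitive_part[of q] g_def by simp
  then have eqs: "b1 * a2 = g * c" "a1 * b2 = g * b" "a2 * b2 = g * a"
    by (simp_all add: q_def)
  have "a \<noteq> 0"
    using eqs(3) ab by auto
  have u: "u = of_int b / of_int a" and v: "v = of_int c / of_int a"
  proof -
    have "u = of_int (a1 * b2) / of_int (a2 * b2)" "v = of_int (b1 * a2) / of_int (a2 * b2)"
      using ab by simp_all
    then show "u = of_int b / of_int a" "v = of_int c / of_int a"
      unfolding eqs using g by simp_all
  qed
  have "of_int a * z\<^sup>2 + of_int b * z + of_int c = of_int a * (z\<^sup>2 + of_rat u * z + of_rat v)"
    using \<open>a \<noteq> 0\<close> by (simp add: u v of_rat_divide field_simps)
  then have "of_int a * z\<^sup>2 + of_int b * z + of_int c = 0"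
    using eq by simp
  moreover have "content [:c, b, a:] = 1"
    using content_primitive_part[OF qn] pp by simp
  ultimately have "is_unit a"
    using algebraic_int_quadratic_lead_coeff_unit assms \<open>a \<noteq> 0\<close> by blast
  then show "u \<in> \<int>" "v \<in> \<int>"
    unfolding u v by (auto simp: zdvd1_eq abs_if split: if_splits)
qed

text \<open>The denominator \<open>v\<close> of \<open>r\<close> satisfies \<open>v^2 dvd D\<close>,
  so it is 1. This controls denominators both of integral elements of \<open>K\<close> and of the
  values of the models.\<close>

lemma squarefree_mult_square_in_Ints:
  fixes D :: int and r :: rat
  assumes "squarefree D" "of_int D * r\<^sup>2 \<in> \<int>"
  shows "r \<in> \<int>"
proof -
  obtain u v where uv: "r = of_int u / of_int v" "v > 0" "coprime u v"
    by (metis quotient_of_div quotient_of_denom_pos quotient_of_coprime surj_pair)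
  obtain n where "of_int D * r\<^sup>2 = of_int n"
    using assms(2) by (auto elim: Ints_cases)
  then have "(of_int (D * u\<^sup>2) :: rat) = of_int (n * v\<^sup>2)"
    using uv by (simp add: field_simps)
  then have "D * u\<^sup>2 = n * v\<^sup>2"
    by (simp only: of_int_eq_iff)
  then have "v\<^sup>2 dvd D * u\<^sup>2"
    by simp
  moreover have "coprime (v\<^sup>2) (u\<^sup>2)"
    using uv(3) by (simp add: coprime_commute)
  ultimately have "v\<^sup>2 dvd D"
    by (simp add: coprime_dvd_mult_left_iff)
  then have "is_unit v"
    using assms(1) squarefreeD by blast
  then show ?thesis
    using uv by (simp add: zdvd1_eq)
qed

lemma squarefree_mod_4_neq_0:
  assumes "squarefree (D :: int)"
  shows "D mod 4 \<noteq> 0"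
proof
  assume "D mod 4 = 0"
  then have "2\<^sup>2 dvd D"
    by (simp add: dvd_eq_mod_eq_0)
  then show False
    using assms squarefreeD[of D 2] by simp
qed

locale quadratic_discriminant =
  fixes D :: int and K :: "complex set"
  assumes squarefree: "squarefree D"
    and nonsquare: "\<nexists>r :: rat. of_int D = r\<^sup>2"
    and K: "K = quadratic_field D"
begin

definition delta :: complex where
  "delta = csqrt (of_int D)"

lemma delta_square: "delta\<^sup>2 = of_int D"
  by (simp add: delta_def)

lemma delta_irrational: "delta \<notin> \<rat>"
proof
  assume "delta \<in> \<rat>"
  then obtain r where "delta = of_rat r"
    by (auto elim: Rats_cases)
  then have "of_rat (of_int D) = (of_rat (r\<^sup>2) :: complex)"
    using delta_square by (simp add: of_rat_power)
  then show False
    using nonsquare by (simp only: of_rat_eq_iff) blast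
qed

lemma rat_independent:
  assumes "of_rat a + of_rat b * delta = 0"
  shows "b = 0"
proof (rule ccontr)
  assume "b \<noteq> 0"
  then have "delta = of_rat (- a / b)"
    using assms by (simp add: of_rat_divide of_rat_minus field_simps add_eq_0_iff)
  then show False
    using delta_irrational by simp
qed

lemma in_field_iff: "z \<in> K \<longleftrightarrow> (\<exists>a b. z = of_rat a + of_rat b * delta)"
  unfolding K quadratic_field_def delta_def by auto

text \<open>Trace and norm of \<open>z\<close> are integers, which leaves at most the denominator 2;
  divisibility by 4 is integrality of the norm, written in the doubled coordinates.\<close>

lemma integer_coordinates:
  assumes "z \<in> K" "algebraic_int z"
  obtains x y :: int where "2 * z = of_int x + of_int y * delta" "4 dvd x\<^sup>2 - y\<^sup>2 * D"
proof -
  obtain a b where z: "z = of_rat a + of_rat b * delta"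
    using assms(1) in_field_iff by blast
  show thesis
  proof (cases "b = 0")
    case True
    then have "z \<in> \<rat>"
      using z by simp
    then have "z \<in> \<int>"
      using assms(2) rational_algebraic_int_is_int by blast
    then obtain c where "z = of_int c"
      by (rule Ints_cases)
    then show thesis
      using that[of "2 * c" 0] by (simp add: power_mult_distrib)
  next
    case False
    have "z \<notin> \<rat>"
    proof
      assume "z \<in> \<rat>"
      then obtain c where "z = of_rat c"
        by (auto elim: Rats_cases)
      then have "of_rat (a - c) + of_rat b * delta = 0"
        using z by (simp add: of_rat_diff algebra_simps)
      then show False
        using False rat_independent by blast
    qed
    \<comment> \<open>Changing the sign of \<open>delta\<close> gives the conjugate, so trace and
      norm of \<open>z\<close> are \<open>2 * a\<close> and \<open>a^2 - b^2 * D\<close>.\<close>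
    have "z\<^sup>2 + of_rat (- 2 * a) * z + of_rat (a\<^sup>2 - b\<^sup>2 * of_int D) =
      of_rat b ^ 2 * (delta\<^sup>2 - of_int D)"
      unfolding z by (simp add: of_rat_diff of_rat_mult of_rat_minus of_rat_power
        algebra_simps power2_eq_square)
    then have "z\<^sup>2 + of_rat (- 2 * a) * z + of_rat (a\<^sup>2 - b\<^sup>2 * of_int D) = 0"
      by (simp add: delta_square)
    from algebraic_int_quadratic_Ints[OF assms(2) \<open>z \<notin> \<rat>\<close> this]
    have "2 * a \<in> \<int>" and n: "a\<^sup>2 - b\<^sup>2 * of_int D \<in> \<int>"
      by simp_all
    then obtain x n where x: "2 * a = of_int x" and n: "a\<^sup>2 - b\<^sup>2 * of_int D = of_int n"
      by (auto elim!: Ints_cases)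
    have "of_int D * (2 * b)\<^sup>2 = (2 * a)\<^sup>2 - 4 * of_int n"
      unfolding n[symmetric] by (simp add: algebra_simps power_mult_distrib)
    also have "\<dots> = of_int (x\<^sup>2 - 4 * n)"
      by (simp add: x)
    finally have eq: "of_int D * (2 * b)\<^sup>2 = of_int (x\<^sup>2 - 4 * n)" .
    then have "2 * b \<in> \<int>"
      using squarefree_mult_square_in_Ints[OF squarefree] Ints_of_int by metis
    then obtain y where y: "2 * b = of_int y"
      by (rule Ints_cases)
    have "(of_int (D * y\<^sup>2) :: rat) = of_int (x\<^sup>2 - 4 * n)"
      using eq y by simp
    then have "D * y\<^sup>2 = x\<^sup>2 - 4 * n"
      by (simp only: of_int_eq_iff)
    then have "x\<^sup>2 - y\<^sup>2 * D = 4 * n"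
      by (simp add: algebra_simps)
    then have "4 dvd x\<^sup>2 - y\<^sup>2 * D"
      by simp
    moreover have "2 * z = of_rat (2 * a) + of_rat (2 * b) * delta"
      unfolding z by (simp add: of_rat_mult algebra_simps)
    ultimately show thesis
      using that[of x y] by (simp add: x y)
  qed
qed

lemma delta_int_independent:
  assumes "of_int c + of_int d * delta = 0"
  shows "c = 0 \<and> d = 0"
proof -
  have "of_rat (of_int c) + of_rat (of_int d) * delta = 0"
    using assms by simp
  from rat_independent[OF this] have "d = 0"
    by simp
  then show ?thesis
    using assms by simp
qed

lemma algebraic_int_quadratic:
  assumes "z\<^sup>2 = of_int t * z + of_int m"
  shows "algebraic_int (z :: complex)"
proof (rule algebraic_int.intros)
  show "lead_coeff [:- of_int m, - of_int t, 1 :: complex:] = 1"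
    by simp
  show "\<forall>i. coeff [:- of_int m, - of_int t, 1 :: complex:] i \<in> \<int>"
    by (auto simp: coeff_pCons split: nat.splits)
  show "poly [:- of_int m, - of_int t, 1:] z = 0"
    using assms by (simp add: algebra_simps power2_eq_square)
qed

lemma quadratic_order_delta:
  assumes "D mod 4 \<noteq> 1"
  shows "quadratic_order (ring_of_integers K) delta 0 D"
proof
  \<comment> \<open>With \<open>D\<close> congruent to 2 or 3 modulo 4, an odd \<open>y\<close>
    would make the square \<open>x^2\<close> congruent to 2 or 3; so \<open>y\<close> is even, and
    then so is \<open>x\<close>.\<close>
  have even_coords: "even x \<and> even y" if dvd: "4 dvd x\<^sup>2 - y\<^sup>2 * D" for x y :: int
  proof -
    have D: "D mod 4 = 2 \<or> D mod 4 = 3"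
      using squarefree_mod_4_neq_0[OF squarefree] assms by presburger
    have "(x\<^sup>2 - y\<^sup>2 * D) mod 4 = 0"
      using dvd by presburger
    then have "((x mod 4)\<^sup>2 - (y mod 4)\<^sup>2 * (D mod 4)) mod 4 = 0"
      using mod_diff_cong[of "x\<^sup>2" 4 "(x mod 4)\<^sup>2" "y\<^sup>2 * D" "(y mod 4)\<^sup>2 * (D mod 4)"]
        mod_mult_cong[of "y\<^sup>2" 4 "(y mod 4)\<^sup>2" D "D mod 4"] by (simp add: power_mod)
    moreover have "x mod 4 \<in> {0, 1, 2, 3}" "y mod 4 \<in> {0, 1, 2, 3}"
      by auto
    ultimately have "x mod 4 \<in> {0, 2} \<and> y mod 4 \<in> {0, 2}"
      using D by auto
    then show ?thesis
      by auto presburger+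
  qed
  have "{z \<in> K. algebraic_int z} = int_span delta"
  proof (intro equalityI subsetI)
    fix z
    assume "z \<in> {z \<in> K. algebraic_int z}"
    then obtain x y where xy: "2 * z = of_int x + of_int y * delta" "4 dvd x\<^sup>2 - y\<^sup>2 * D"
      using integer_coordinates by blast
    obtain c d where "x = 2 * c" "y = 2 * d"
      using even_coords[OF xy(2)] by (auto elim!: evenE)
    with xy(1) have "2 * z = 2 * (of_int c + of_int d * delta)"
      by (simp add: algebra_simps)
    then have "z = of_int c + of_int d * delta"
      by (simp only: mult_cancel_left) simp
    then show "z \<in> int_span delta"
      unfolding int_span_def by auto
  next
    fix z
    assume "z \<in> int_span delta"
    then obtain c d where z: "z = of_int c + of_int d * delta"
      unfolding int_span_def by blast
    have "z\<^sup>2 = of_int (2 * c) * z + of_int (d\<^sup>2 * D - c\<^sup>2)"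
      unfolding z of_int_diff of_int_mult of_int_power delta_square[symmetric]
      by (simp add: algebra_simps power2_eq_square)
    moreover have "z = of_rat (of_int c) + of_rat (of_int d) * delta"
      by (simp add: z)
    ultimately show "z \<in> {z \<in> K. algebraic_int z}"
      using algebraic_int_quadratic in_field_iff by blast
  qed
  then show "ring_of_integers K = \<lparr>carrier = int_span delta, mult = (*), one = 1, zero = 0, add = (+)\<rparr>"
    by (simp add: ring_of_integers_def)
  show "delta\<^sup>2 = of_int 0 * delta + of_int D"
    by (simp add: delta_square)
qed (rule delta_int_independent)

lemma quadratic_order_half:
  assumes "D = 4 * k + 1"
  shows "quadratic_order (ring_of_integers K) ((1 + delta) / 2) 1 k"
proof
  let ?w = "(1 + delta) / 2"
  have sq: "?w\<^sup>2 = of_int 1 * ?w + of_int k"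
  proof -
    have "?w\<^sup>2 = (1 + 2 * delta + delta\<^sup>2) / 4"
      by (simp add: power2_eq_square field_simps)
    also have "\<dots> = (1 + 2 * delta + (4 * of_int k + 1)) / 4"
      unfolding delta_square by (simp add: assms(1))
    finally show ?thesis
      by (simp add: field_simps)
  qed
  then show "?w\<^sup>2 = of_int 1 * ?w + of_int k" .
  show "c = 0 \<and> d = 0" if "of_int c + of_int d * ?w = 0" for c d
  proof -
    have "of_int (2 * c + d) + of_int d * delta = 2 * (of_int c + of_int d * ?w)"
      by (simp add: field_simps)
    also have "\<dots> = 0"
      by (simp only: that mult_zero_right)
    finally show ?thesis
      using delta_int_independent[of "2 * c + d" d] by simp
  qed
  \<comment> \<open>\<open>D\<close> is odd, so divisibility by 2 already equates the parities,
    which is what the basis \<open>1, ?w\<close> requires.\<close>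
  have same_parity: "even (x - y)" if "4 dvd x\<^sup>2 - y\<^sup>2 * D" for x y :: int
  proof -
    have "even (x\<^sup>2 - y\<^sup>2 * D)"
      using that by (rule dvd_trans[rotated]) simp
    then show ?thesis
      using assms by simp
  qed
  have "{z \<in> K. algebraic_int z} = int_span ?w"
  proof (intro equalityI subsetI)
    fix z
    assume "z \<in> {z \<in> K. algebraic_int z}"
    then obtain x y where xy: "2 * z = of_int x + of_int y * delta" "4 dvd x\<^sup>2 - y\<^sup>2 * D"
      using integer_coordinates by blast
    obtain c where "x - y = 2 * c"
      using same_parity[OF xy(2)] by (rule evenE)
    then have "x = y + 2 * c"
      by simp
    with xy(1) have "z = of_int c + of_int y * ?w"
      by (simp add: field_simps)
    then show "z \<in> int_span ?w"
      unfolding int_span_def by auto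
  next
    fix z
    assume "z \<in> int_span ?w"
    then obtain c d where z: "z = of_int c + of_int d * ?w"
      unfolding int_span_def by blast
    \<comment> \<open>The square after replacing \<open>?w^2\<close> by \<open>?w + k\<close>, as a
      polynomial identity in a free \<open>w\<close>. It exhibits the trace \<open>2 * c + d\<close>
      and the norm \<open>c^2 + c * d - d^2 * k\<close> of \<open>z\<close>.\<close>
    have expand: "of_int c ^ 2 + 2 * of_int c * of_int d * w + of_int d ^ 2 * (of_int 1 * w + of_int k) =
        of_int (2 * c + d) * (of_int c + of_int d * w) + of_int (d\<^sup>2 * k - c\<^sup>2 - c * d)" for w :: complex
      by (simp add: algebra_simps power2_eq_square)
    have "z\<^sup>2 = of_int c ^ 2 + 2 * of_int c * of_int d * ?w + of_int d ^ 2 * ?w\<^sup>2"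
      unfolding z by (simp only: power2_sum power_mult_distrib) (simp add: mult_ac)
    also have "\<dots> = of_int (2 * c + d) * z + of_int (d\<^sup>2 * k - c\<^sup>2 - c * d)"
      unfolding sq z by (rule expand)
    finally have "algebraic_int z"
      by (rule algebraic_int_quadratic)
    moreover have "z = of_rat (of_int c + of_int d / 2) + of_rat (of_int d / 2) * delta"
      by (simp add: z of_rat_add of_rat_mult of_rat_divide field_simps)
    ultimately show "z \<in> {z \<in> K. algebraic_int z}"
      using in_field_iff by blast
  qed
  then show "ring_of_integers K = \<lparr>carrier = int_span ?w, mult = (*), one = 1, zero = 0, add = (+)\<rparr>"
    by (simp add: ring_of_integers_def)
qed

text \<open>A square root \<open>s\<close> of \<open>D\<close> modulo an odd \<open>p\<close> may be taken odd, and then \<open>(s + 1) / 2\<close> is a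
  root of the minimal polynomial of \<open>(1 + \<surd>D) / 2\<close>.\<close>

lemma half_root_mod:
  assumes "odd (p :: int)" "p dvd s\<^sup>2 - D" "D = 4 * k + 1"
  obtains s' where "p dvd s'\<^sup>2 - 1 * s' - k" "p dvd 2 * s' - 1 - s"
proof -
  define s0 where "s0 = (if odd s then s else s + p)"
  have "odd s0"
    using assms(1) by (simp add: s0_def)
  then obtain u where u: "s0 = 2 * u + 1"
    by (rule oddE)
  have ps: "p dvd s0 - s"
    by (simp add: s0_def)
  then have "p dvd (s0 - s) * (s0 + s) + (s\<^sup>2 - D)"
    using assms(2) by (intro dvd_add dvd_mult2)
  also have "(s0 - s) * (s0 + s) + (s\<^sup>2 - D) = 4 * ((u + 1)\<^sup>2 - 1 * (u + 1) - k)"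
    unfolding assms(3) u by (simp add: algebra_simps power2_eq_square)
  finally have "p dvd 4 * ((u + 1)\<^sup>2 - 1 * (u + 1) - k)" .
  moreover have "coprime p 4"
    using assms(1) coprime_power_right_iff[of p 2 2] by simp
  ultimately have "p dvd (u + 1)\<^sup>2 - 1 * (u + 1) - k"
    using coprime_dvd_mult_right_iff by blast
  moreover have "p dvd 2 * (u + 1) - 1 - s"
    using ps u by (simp add: algebra_simps)
  ultimately show thesis
    by (rule that)
qed

section \<open>Decomposition of primes read off from \<open>D\<close>\<close>

lemma not_inert_odd:
  assumes "prime p" "odd p" "int p dvd s\<^sup>2 - D"
  shows "\<not> inert_in p K"
proof (cases "D mod 4 = 1")
  case True
  then obtain k where k: "D = 4 * k + 1"
    by (metis mult_div_mod_eq)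
  interpret quadratic_order "ring_of_integers K" "(1 + delta) / 2" 1 k
    by (rule quadratic_order_half[OF k])
  obtain s' where "int p dvd s'\<^sup>2 - 1 * s' - k"
    using half_root_mod[OF _ assms(3) k] assms(2) by auto
  then show ?thesis
    using not_primeideal_principal[of "int p" s'] assms(1) by (simp add: inert_in_def)
next
  case False
  interpret quadratic_order "ring_of_integers K" delta 0 D
    by (rule quadratic_order_delta[OF False])
  show ?thesis
    using not_primeideal_principal[of "int p" s] assms by (simp add: inert_in_def)
qed

text \<open>As \<open>p\<close> does not divide \<open>D\<close>, the square root \<open>s\<close>
  is a unit modulo \<open>p\<close>, and for odd \<open>p\<close> this separates the two roots of
  the minimal polynomial.\<close>

lemma splits_odd:
  assumes "prime p" "odd p" "int p dvd s\<^sup>2 - D" "\<not> int p dvd D"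
  shows "splits_in p K"
proof -
  have "\<not> int p dvd s"
  proof
    assume "int p dvd s"
    then have "int p dvd s\<^sup>2"
      by (simp add: power2_eq_square)
    then show False
      using assms(3,4) dvd_diff[of "int p" "s\<^sup>2" "s\<^sup>2 - D"] by simp
  qed
  show ?thesis
  proof (cases "D mod 4 = 1")
    case True
    then obtain k where k: "D = 4 * k + 1"
      by (metis mult_div_mod_eq)
    interpret quadratic_order "ring_of_integers K" "(1 + delta) / 2" 1 k
      by (rule quadratic_order_half[OF k])
    obtain s' where s': "int p dvd s'\<^sup>2 - 1 * s' - k" "int p dvd 2 * s' - 1 - s"
      using half_root_mod[OF _ assms(3) k] assms(2) by auto
    \<comment> \<open>The roots \<open>s'\<close> and \<open>1 - s'\<close> differ by
      \<open>2 * s' - 1\<close>, which is \<open>s\<close> modulo \<open>p\<close>.\<close>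
    have "\<not> int p dvd 2 * s' - 1"
      using \<open>\<not> int p dvd s\<close> dvd_diff[OF _ s'(2), of "2 * s' - 1"] by auto
    then show ?thesis
      using principal_eq_prod_root_ideals[of "int p" s'] s'(1) assms(1) by (simp add: splits_in_def)
  next
    case False
    interpret quadratic_order "ring_of_integers K" delta 0 D
      by (rule quadratic_order_delta[OF False])
    have "coprime (int p) 2"
      using assms(2) by simp
    then have "\<not> int p dvd 2 * s - 0"
      using \<open>\<not> int p dvd s\<close> by (simp add: coprime_dvd_mult_right_iff)
    then show ?thesis
      using principal_eq_prod_root_ideals[of "int p" s] assms by (simp add: splits_in_def)
  qed
qed

text \<open>For \<open>D = 4 * k + 1\<close> with \<open>k\<close> even, the minimal polynomial
  \<open>X^2 - X - k\<close> has the distinct roots 0 and 1 modulo 2.\<close>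

lemma splits_2:
  assumes "D mod 8 = 1"
  shows "splits_in 2 K"
proof -
  have k: "D = 4 * (2 * (D div 8)) + 1"
    using assms by presburger
  interpret quadratic_order "ring_of_integers K" "(1 + delta) / 2" 1 "2 * (D div 8)"
    by (rule quadratic_order_half[OF k])
  show ?thesis
    using principal_eq_prod_root_ideals[of 2 0] by (simp add: splits_in_def)
qed

text \<open>In both cases 0 is a root modulo 2 of the minimal polynomial: \<open>X^2 - D\<close> for
  even \<open>D\<close>, otherwise \<open>X^2 - X - k\<close> with \<open>k\<close> even.\<close>

lemma not_inert_2:
  assumes "D mod 8 = 1 \<or> even D"
  shows "\<not> inert_in 2 K"
proof (cases "even D")
  case True
  then have "D mod 4 \<noteq> 1"
    by presburger
  interpret quadratic_order "ring_of_integers K" delta 0 D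
    by (rule quadratic_order_delta) fact
  show ?thesis
    using not_primeideal_principal[of 2 0] True by (simp add: inert_in_def)
next
  case False
  with assms have k: "D = 4 * (2 * (D div 8)) + 1"
    by presburger
  interpret quadratic_order "ring_of_integers K" "(1 + delta) / 2" 1 "2 * (D div 8)"
    by (rule quadratic_order_half[OF k])
  show ?thesis
    using not_primeideal_principal[of 2 0] by (simp add: inert_in_def)
qed

lemma not_ramified_2:
  assumes "D mod 4 = 1"
  shows "\<not> ramified_in 2 K"
proof -
  obtain k where k: "D = 4 * k + 1"
    using assms by (metis mult_div_mod_eq)
  interpret quadratic_order "ring_of_integers K" "(1 + delta) / 2" 1 k
    by (rule quadratic_order_half[OF k])
  have "PIdl\<^bsub>ring_of_integers K\<^esub> (of_nat 2) \<noteq> P \<cdot>\<^bsub>ring_of_integers K\<^esub> P"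
    if "primeideal P (ring_of_integers K)" for P
    using principal_2_neq_square[OF _ primeideal.axioms(1)[OF that]] by simp
  then show ?thesis
    unfolding ramified_in_def Let_def by blast
qed

end

section \<open>Local conditions on squarefree parts of values of binary forms\<close>

text \<open>The coefficients are listed by increasing powers of the first variable.\<close>

primrec binary_form :: "int list \<Rightarrow> int \<Rightarrow> int \<Rightarrow> int" where
  "binary_form [] a b = 0"
| "binary_form (c # cs) a b = c * b ^ length cs + a * binary_form cs a b"

text \<open>Coefficients of \<open>F(x * b + p * a, b)\<close> by Horner's rule: a new head
  multiplies by the first variable, a trailing 0 by the second. With \<open>x\<close> a residue
  modulo \<open>p\<close> this zooms into the disc of \<open>a / b\<close> around
  \<open>x\<close>.\<close>

primrec form_subst :: "int \<Rightarrow> int \<Rightarrow> int list \<Rightarrow> int list" where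
  "form_subst p x [] = []"
| "form_subst p x (c # cs) =
    (let s = form_subst p x cs in map2 (+) (c # map ((*) p) s) (map ((*) x) s @ [0]))"

lemma length_form_subst [simp]: "length (form_subst p x cs) = length cs"
  by (induction cs) (simp_all add: Let_def)

lemma binary_form_map2_add:
  "length xs = length ys \<Longrightarrow>
    binary_form (map2 (+) xs ys) a b = binary_form xs a b + binary_form ys a b"
  by (induction xs ys rule: list_induct2) (simp_all add: algebra_simps)

lemma binary_form_map_mult: "binary_form (map ((*) k) xs) a b = k * binary_form xs a b"
  by (induction xs) (simp_all add: algebra_simps)

lemma binary_form_snoc:
  "binary_form (xs @ [c]) a b = b * binary_form xs a b + c * a ^ length xs"
  by (induction xs) (simp_all add: algebra_simps)

lemma binary_form_rev: "binary_form (rev xs) b a = binary_form xs a b"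
  by (induction xs) (simp_all add: binary_form_snoc)

lemma binary_form_subst:
  "binary_form (form_subst p x cs) a b = binary_form cs (x * b + p * a) b"
proof (induction cs)
  case (Cons c cs)
  then show ?case
    by (simp add: Let_def binary_form_map2_add binary_form_map_mult binary_form_snoc algebra_simps
        del: zip_Cons_Cons list.map)
qed simp

lemma dvd_binary_form: "list_all ((dvd) k) cs \<Longrightarrow> k dvd binary_form cs a b"
  by (induction cs) auto

lemma binary_form_div:
  "list_all ((dvd) k) cs \<Longrightarrow> binary_form cs a b = k * binary_form (map (\<lambda>c. c div k) cs) a b"
  by (induction cs) (auto simp: algebra_simps)

text \<open>A search tree over the residues of \<open>a / b\<close> modulo powers of \<open>p\<close>, for \<open>b\<close> prime to \<open>p\<close>.
  A leaf is reached once the value is determined up to squares: either it has odd valuation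
  (accepted if \<open>e\<close> holds), or it is a unit times an even power of \<open>p\<close>, the unit being congruent
  to a square times an element of \<open>A\<close> modulo \<open>q\<close>.\<close>

fun local_search :: "int \<Rightarrow> int \<Rightarrow> int list \<Rightarrow> bool \<Rightarrow> nat \<Rightarrow> int list \<Rightarrow> bool" where
  "local_search p q A e 0 cs = False"
| "local_search p q A e (Suc n) [] = False"
| "local_search p q A e (Suc n) (c # cs) =
    (if list_all ((dvd) (p * p)) (c # cs) then local_search p q A e n (map (\<lambda>c. c div (p * p)) (c # cs))
     else if p dvd c \<and> e \<and> \<not> p * p dvd c \<and> list_all ((dvd) (p * p)) cs then True
     else if c mod q \<in> set A \<and> list_all ((dvd) q) cs then True
     else list_all (\<lambda>x. local_search p q A e n (form_subst p x (c # cs))) [0..p - 1])"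

text \<open>Units \<open>s\<close> and \<open>t\<close> on both sides place \<open>D\<close> in the
  square class of \<open>u\<close> without inverting anything modulo \<open>q\<close>.\<close>

definition local_class :: "int \<Rightarrow> int \<Rightarrow> int list \<Rightarrow> bool \<Rightarrow> int \<Rightarrow> bool" where
  "local_class p q A e D \<longleftrightarrow> e \<and> p dvd D \<or>
    (\<exists>u\<in>set A. \<exists>s t. \<not> p dvd s \<and> \<not> p dvd t \<and> [D * s\<^sup>2 = u * t\<^sup>2] (mod q))"

lemma squarefree_prime_square_dvd:
  fixes p D r :: int
  assumes "prime p" "squarefree D" "p * p dvd D * r\<^sup>2"
  shows "p dvd r"
proof (rule ccontr)
  assume "\<not> p dvd r"
  then have "coprime (p * p) (r\<^sup>2)"
    using assms(1) prime_imp_coprime by (simp add: coprime_commute)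
  then have "p\<^sup>2 dvd D"
    using assms(3) by (simp add: coprime_dvd_mult_left_iff power2_eq_square)
  then show False
    using assms(1,2) squarefreeD not_prime_unit by blast
qed

lemma residue_quotient:
  fixes p a b :: int
  assumes "prime p" "\<not> p dvd b"
  obtains x a' where "x \<in> {0..p - 1}" "a = x * b + p * a'"
proof -
  have "coprime b p"
    using assms prime_imp_coprime coprime_commute by blast
  then obtain u v where uv: "u * b + v * p = 1"
    using bezout_int[of b p] by (metis coprime_imp_gcd_eq_1)
  \<comment> \<open>\<open>u\<close> inverts \<open>b\<close> modulo \<open>p\<close>, so
    \<open>x\<close> is the residue of \<open>a / b\<close>.\<close>
  define x where "x = (a * u) mod p"
  have "p > 0"
    using assms(1) prime_gt_0_int by blast
  then have "x \<in> {0..p - 1}"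
    unfolding x_def by (simp add: zle_diff1_eq)
  moreover have "a = x * b + p * (a * v + (a * u) div p * b)"
  proof -
    have "a = a * (u * b + v * p)"
      by (simp add: uv)
    also have "\<dots> = (a * u) * b + p * (a * v)"
      by (simp add: algebra_simps)
    also have "a * u = x + p * ((a * u) div p)"
      unfolding x_def by simp
    finally show ?thesis
      by (simp add: algebra_simps)
  qed
  ultimately show thesis
    by (rule that)
qed

text \<open>Induction along the search: removing content replaces \<open>r\<close> by
  \<open>r / p\<close>, and branching changes only \<open>a\<close>, so \<open>b\<close> stays prime
  to \<open>p\<close>.\<close>

lemma local_search_sound:
  assumes "local_search p q A e n cs" "prime p" "p dvd q" "\<forall>u\<in>set A. \<not> p dvd u"
    and "odd (length cs)" "\<not> p dvd b" "squarefree D" "binary_form cs a b = D * r\<^sup>2" "r \<noteq> 0"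
  shows "local_class p q A e D"
  using assms
proof (induction p q A e n cs arbitrary: a r rule: local_search.induct)
  case (3 p q A e n c cs)
  note p = \<open>prime p\<close>
  note val = \<open>binary_form (c # cs) a b = D * r\<^sup>2\<close>
  obtain k where k: "length cs = 2 * k"
    using 3 by (auto elim!: evenE)
  \<comment> \<open>The degree is \<open>2 * k\<close>, so the head coefficient enters the value
    multiplied by a square prime to \<open>p\<close>.\<close>
  define t where "t = b ^ k"
  have t: "\<not> p dvd t"
    using p \<open>\<not> p dvd b\<close> prime_dvd_power unfolding t_def by blast
  have val': "D * r\<^sup>2 = c * t\<^sup>2 + a * binary_form cs a b"
    using val by (simp add: k t_def power_mult[symmetric] mult.commute)
  consider (content) "list_all ((dvd) (p * p)) (c # cs)"
    | (ramified) "p dvd c" "e" "\<not> p * p dvd c" "list_all ((dvd) (p * p)) cs"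
    | (unit) "c mod q \<in> set A" "list_all ((dvd) q) cs"
    | (branch) "\<not> list_all ((dvd) (p * p)) (c # cs)"
      "\<not> (p dvd c \<and> e \<and> \<not> p * p dvd c \<and> list_all ((dvd) (p * p)) cs)"
      "\<not> (c mod q \<in> set A \<and> list_all ((dvd) q) cs)"
    by blast
  then show ?case
  proof cases
    case content
    define F where "F = binary_form (map (\<lambda>c. c div (p * p)) (c # cs)) a b"
    have F: "D * r\<^sup>2 = p * p * F"
      using binary_form_div[OF content] val unfolding F_def by metis
    then have "p dvd r"
      using squarefree_prime_square_dvd[OF p \<open>squarefree D\<close>] by simp
    then obtain r' where r': "r = p * r'"
      by (rule dvdE)
    have "p * p * F = p * p * (D * r'\<^sup>2)"
      unfolding F[symmetric] r' by (simp add: power2_eq_square)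
    then have "F = D * r'\<^sup>2"
      using p by simp
    moreover have "r' \<noteq> 0"
      using \<open>r \<noteq> 0\<close> r' by simp
    moreover have "local_search p q A e n (map (\<lambda>c. c div (p * p)) (c # cs))"
      using "3.prems"(1) content by (simp del: list.map)
    moreover have "odd (length (map (\<lambda>c. c div (p * p)) (c # cs)))"
      using \<open>odd (length (c # cs))\<close> by simp
    ultimately show ?thesis
      using "3.IH"(1)[OF content] "3.prems" unfolding F_def by blast
  next
    case ramified
    have "p dvd D"
    proof (rule ccontr)
      \<comment> \<open>Then \<open>p\<close> divides \<open>r\<close> and \<open>p * p\<close>
        divides the value. It also divides the contribution of the tail, so it would divide
        \<open>c\<close>.\<close>
      assume "\<not> p dvd D"
      have pp: "p * p dvd a * binary_form cs a b"
        using dvd_binary_form[OF ramified(4)] by (rule dvd_mult)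
      then have "p dvd D * r\<^sup>2"
        unfolding val' using ramified(1) dvd_mult_left by (metis dvd_add dvd_mult2)
      then have "p dvd r"
        using p \<open>\<not> p dvd D\<close> by (simp add: prime_dvd_mult_iff prime_dvd_power_iff)
      then have "p * p dvd D * r\<^sup>2"
        by (simp add: power2_eq_square mult_dvd_mono)
      then have "p * p dvd c * t\<^sup>2"
        unfolding val' using pp dvd_add_left_iff by blast
      moreover have "coprime (p * p) (t\<^sup>2)"
        using t p prime_imp_coprime by (simp add: coprime_commute)
      ultimately show False
        using ramified(3) by (simp add: coprime_dvd_mult_left_iff)
    qed
    then show ?thesis
      using ramified unfolding local_class_def by blast
  next
    case unit
    have q: "q dvd a * binary_form cs a b"
      using dvd_binary_form[OF unit(2)] by (rule dvd_mult)
    have "\<not> p dvd c"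
      using unit(1) \<open>\<forall>u\<in>set A. \<not> p dvd u\<close> \<open>p dvd q\<close> by (metis dvd_mod_iff)
    have "\<not> p dvd r"
    proof
      assume "p dvd r"
      then have "p dvd D * r\<^sup>2"
        by (simp add: power2_eq_square)
      moreover have "p dvd a * binary_form cs a b"
        using q \<open>p dvd q\<close> dvd_trans by blast
      ultimately have "p dvd c * t\<^sup>2"
        unfolding val' using dvd_add_left_iff by blast
      then show False
        using p t \<open>\<not> p dvd c\<close> by (simp add: prime_dvd_mult_iff prime_dvd_power_iff)
    qed
    moreover have "[D * r\<^sup>2 = (c mod q) * t\<^sup>2] (mod q)"
    proof -
      have "[D * r\<^sup>2 = c * t\<^sup>2] (mod q)"
        unfolding val' using q by (simp add: cong_iff_dvd_diff)
      also have "[c * t\<^sup>2 = (c mod q) * t\<^sup>2] (mod q)"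
        by (intro cong_mult) (simp_all add: cong_def)
      finally show ?thesis .
    qed
    ultimately show ?thesis
      using unit(1) t unfolding local_class_def by blast
  next
    case branch
    obtain x a' where x: "x \<in> {0..p - 1}" and a: "a = x * b + p * a'"
      using residue_quotient[OF p \<open>\<not> p dvd b\<close>] .
    have "list_all (\<lambda>x. local_search p q A e n (form_subst p x (c # cs))) [0..p - 1]"
      using "3.prems"(1) branch unfolding local_search.simps by (simp only: if_False split: if_splits)
    then have "local_search p q A e n (form_subst p x (c # cs))"
      using x unfolding list_all_iff by auto
    moreover have "binary_form (form_subst p x (c # cs)) a' b = D * r\<^sup>2"
      unfolding binary_form_subst a[symmetric] by (rule val)
    moreover have "odd (length (form_subst p x (c # cs)))"
      unfolding length_form_subst by (rule \<open>odd (length (c # cs))\<close>)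
    ultimately show ?thesis
      using "3.IH"(2)[OF branch, of x] x "3.prems" by auto
  qed
qed simp_all

text \<open>The fuel 10 bounds the depth of the tree; an exhausted search fails, so soundness does
  not depend on the number.\<close>

definition local_test :: "int \<Rightarrow> int \<Rightarrow> int list \<Rightarrow> bool \<Rightarrow> int list \<Rightarrow> bool" where
  "local_test p q A e cs \<longleftrightarrow>
    local_search p q A e 10 cs \<and> local_search p q A e 10 (form_subst p 0 (rev cs))"

text \<open>The second search covers the residue disc at infinity, \<open>p dvd b\<close>.\<close>

lemma local_test_sound:
  assumes "local_test p q A e cs" "prime p" "p dvd q" "\<forall>u\<in>set A. \<not> p dvd u"
    and "odd (length cs)" "coprime a b" "squarefree D" "binary_form cs a b = D * r\<^sup>2" "r \<noteq> 0"
  shows "local_class p q A e D"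
proof (cases "p dvd b")
  case False
  then show ?thesis
    using local_search_sound assms unfolding local_test_def by blast
next
  case True
  then obtain b' where b': "b = p * b'"
    by (rule dvdE)
  have "\<not> p dvd a"
    using True assms(2,6) not_coprimeI not_prime_unit by blast
  moreover have "binary_form (form_subst p 0 (rev cs)) b' a = D * r\<^sup>2"
    unfolding binary_form_subst using assms(8) by (simp add: b' binary_form_rev)
  moreover have "odd (length (form_subst p 0 (rev cs)))"
    using assms(5) by simp
  ultimately show ?thesis
    using local_search_sound assms unfolding local_test_def by blast
qed

text \<open>\<open>w\<close> and \<open>p - w\<close> have the same square, so the range up to
  \<open>p div 2\<close> yields all nonzero squares modulo \<open>p\<close>. A class
  \<open>u = w^2\<close> makes \<open>D\<close> the square of \<open>w * t / s\<close>; if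
  \<open>p\<close> divides \<open>D\<close>, the root is 0.\<close>

lemma local_test_odd_prime:
  assumes "local_test p p (map (\<lambda>w. w * w mod p) [1..p div 2]) e cs" "prime p" "p > 2"
    and "odd (length cs)" "coprime a b" "squarefree D" "binary_form cs a b = D * r\<^sup>2" "r \<noteq> 0"
  shows "\<exists>s. p dvd s\<^sup>2 - D" "\<not> e \<Longrightarrow> \<not> p dvd D"
proof -
  define A where "A = map (\<lambda>w. w * w mod p) [1..p div 2]"
  have nz: "\<forall>u\<in>set A. \<not> p dvd u"
  proof
    fix u
    assume "u \<in> set A"
    then obtain w where w: "1 \<le> w" "w \<le> p div 2" "u = w * w mod p"
      by (auto simp: A_def)
    have "\<not> p dvd w"
      using w assms(3) zdvd_imp_le[of p w] by linarith
    then show "\<not> p dvd u"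
      using w(3) assms(2) by (simp add: dvd_mod_iff prime_dvd_mult_iff)
  qed
  have lc: "local_class p p A e D"
    using local_test_sound[OF assms(1)[folded A_def] assms(2) dvd_refl nz] assms(4-8) by blast
  have unit: "(\<exists>s. p dvd s\<^sup>2 - D) \<and> \<not> p dvd D"
    if st: "u \<in> set A" "\<not> p dvd s" "\<not> p dvd t" "[D * s\<^sup>2 = u * t\<^sup>2] (mod p)" for u s t
  proof
    obtain w where w: "u = w * w mod p"
      using st(1) by (auto simp: A_def)
    have "coprime s p"
      using st(2) assms(2) prime_imp_coprime coprime_commute by blast
    then obtain v where v: "[s * v = 1] (mod p)"
      using cong_solve_coprime_int by blast
    have "[(w * w) * t\<^sup>2 = u * t\<^sup>2] (mod p)"
      unfolding w by (intro cong_scalar_right) (simp add: cong_def)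
    also have "[u * t\<^sup>2 = D * s\<^sup>2] (mod p)"
      using st(4) by (rule cong_sym)
    finally have "[(w * w) * t\<^sup>2 * v\<^sup>2 = D * s\<^sup>2 * v\<^sup>2] (mod p)"
      by (rule cong_scalar_right)
    also have "D * s\<^sup>2 * v\<^sup>2 = D * (s * v)\<^sup>2"
      by (simp add: power_mult_distrib)
    also have "[D * (s * v)\<^sup>2 = D * 1\<^sup>2] (mod p)"
      using v by (intro cong_scalar_left cong_pow)
    also have "(w * w) * t\<^sup>2 * v\<^sup>2 = (w * t * v)\<^sup>2"
      by (simp add: power2_eq_square)
    finally have "[(w * t * v)\<^sup>2 = D] (mod p)"
      by simp
    then show "\<exists>s. p dvd s\<^sup>2 - D"
      unfolding cong_iff_dvd_diff by blast
    show "\<not> p dvd D"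
    proof
      assume "p dvd D"
      then have "p dvd u * t\<^sup>2"
        using st(4) by (metis cong_dvd_iff dvd_mult2)
      then show False
        using st(1,3) nz assms(2) by (simp add: prime_dvd_mult_iff prime_dvd_power_iff)
    qed
  qed
  show "\<exists>s. p dvd s\<^sup>2 - D"
  proof (cases "p dvd D")
    case True
    then show ?thesis
      by (intro exI[of _ 0]) simp
  next
    case False
    then show ?thesis
      using lc unit unfolding local_class_def by blast
  qed
  show "\<not> p dvd D" if "\<not> e"
    using lc unit that unfolding local_class_def by blast
qed

lemma odd_square_mod_8:
  assumes "odd (s :: int)"
  shows "s\<^sup>2 mod 8 = 1"
proof -
  obtain k where k: "s = 2 * k + 1"
    using assms by (rule oddE)
  have "even (k * (k + 1))"
    by simp
  then obtain l where "k * (k + 1) = 2 * l"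
    by (rule evenE)
  then have "s\<^sup>2 = 8 * l + 1"
    unfolding k by (simp add: power2_eq_square algebra_simps)
  then show ?thesis
    by simp
qed

text \<open>Odd squares are 1 modulo 8, so the unit squares in \<open>local_class\<close> disappear
  modulo each \<open>q\<close> dividing 8.\<close>

lemma local_test_2:
  assumes "local_test 2 q A e cs" "q dvd 8" "even q" "\<forall>u\<in>set A. odd u"
    and "odd (length cs)" "coprime a b" "squarefree D" "binary_form cs a b = D * r\<^sup>2" "r \<noteq> 0"
  shows "e \<and> even D \<or> (\<exists>u\<in>set A. [D = u] (mod q))"
proof -
  have "local_class 2 q A e D"
    using local_test_sound[OF assms(1) two_is_prime(1) assms(3,4)] assms(5-9) by (simp add: two_is_prime)
  moreover have "[D = u] (mod q)"
    if st: "odd s" "odd t" "[D * s\<^sup>2 = u * t\<^sup>2] (mod q)" for s t u :: int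
  proof -
    have one: "[x\<^sup>2 = 1] (mod q)" if "odd x" for x
      using odd_square_mod_8[OF that] assms(2) cong_dvd_modulus[of "x\<^sup>2" 1 8 q] by (simp add: cong_def)
    have "[D * s\<^sup>2 = D * 1] (mod q)" "[u * t\<^sup>2 = u * 1] (mod q)"
      using st one by (blast intro: cong_scalar_left)+
    then show ?thesis
      using st(3) by (metis cong_sym cong_trans mult.right_neutral)
  qed
  ultimately show ?thesis
    unfolding local_class_def by blast
qed

section \<open>Prime factors modulo 5\<close>

text \<open>For \<open>q\<close> other than 5, 5 is the square of \<open>u / v\<close> modulo
  \<open>q\<close>. By reciprocity, with trivial sign because 5 is 1 modulo 4, \<open>q\<close> is a
  square modulo 5.\<close>

lemma prime_dvd_norm_sqrt5_mod_5:
  fixes q u v :: int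
  assumes "prime q" "odd q" "q dvd u\<^sup>2 - 5 * v\<^sup>2" "\<not> q dvd v"
  shows "q mod 5 \<in> {0, 1, 4}"
proof (cases "q = 5")
  case False
  have q2: "q > 2"
    using assms(1,2) prime_ge_2_int[of q] by (cases "q = 2") auto
  have p5: "prime (5 :: int)"
    by simp
  have "coprime v q"
    using assms(1,4) prime_imp_coprime coprime_commute by blast
  then obtain w where w: "[v * w = 1] (mod q)"
    using cong_solve_coprime_int by blast
  have "[u\<^sup>2 = 5 * v\<^sup>2] (mod q)"
    using assms(3) by (simp add: cong_iff_dvd_diff)
  then have "[u\<^sup>2 * w\<^sup>2 = 5 * v\<^sup>2 * w\<^sup>2] (mod q)"
    by (rule cong_scalar_right)
  also have "5 * v\<^sup>2 * w\<^sup>2 = 5 * (v * w)\<^sup>2"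
    by (simp add: power_mult_distrib)
  also have "[5 * (v * w)\<^sup>2 = 5 * 1\<^sup>2] (mod q)"
    using w by (intro cong_scalar_left cong_pow)
  also have "u\<^sup>2 * w\<^sup>2 = (u * w)\<^sup>2"
    by (simp add: power_mult_distrib)
  finally have "QuadRes q 5"
    unfolding QuadRes_def by auto
  moreover have "\<not> [5 = 0] (mod q)"
    using False assms(1) p5 primes_dvd_imp_eq unfolding cong_0_iff by blast
  ultimately have "Legendre 5 q = 1"
    by (simp add: Legendre_def)
  moreover have "Legendre 5 q * Legendre q 5 = (-1) ^ nat ((5 - 1) div 2 * ((q - 1) div 2))"
    using assms(1) q2 False by (intro Quadratic_Reciprocity_int) auto
  moreover have "even (nat ((5 - 1) div 2 * ((q - 1) div 2)))"
    using q2 by (simp add: even_nat_iff)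
  ultimately have "Legendre q 5 = 1"
    by simp
  then have "QuadRes 5 q"
    by (auto simp: Legendre_def split: if_splits)
  then obtain y where "y\<^sup>2 mod 5 = q mod 5"
    unfolding QuadRes_def cong_def by blast
  then have "q mod 5 = (y mod 5)\<^sup>2 mod 5"
    by (simp add: power_mod)
  moreover have "y mod 5 \<in> {0, 1, 2, 3, 4}"
    by auto
  ultimately show ?thesis
    by auto
qed auto

text \<open>If \<open>q\<close> divided \<open>b\<close>, it would divide \<open>k * a\<close> and
  hence \<open>a\<close>, against coprimality; so the norm criterion applies.\<close>

lemma prime_dvd_quadratic_norm_mod_5:
  fixes q k a b c :: int
  assumes "prime q" "odd q" "coprime a b" "\<not> q dvd k" "q dvd (k * a + c * b)\<^sup>2 - 5 * b\<^sup>2"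
  shows "q mod 5 \<in> {0, 1, 4}"
proof (rule prime_dvd_norm_sqrt5_mod_5[OF assms(1,2,5)])
  show "\<not> q dvd b"
  proof
    assume b: "q dvd b"
    then have "q dvd 5 * b\<^sup>2"
      by (simp add: power2_eq_square)
    then have "q dvd (k * a + c * b)\<^sup>2"
      using assms(5) dvd_add[of q "(k * a + c * b)\<^sup>2 - 5 * b\<^sup>2" "5 * b\<^sup>2"] by simp
    then have "q dvd k * a + c * b"
      using assms(1) prime_dvd_power by blast
    then have "q dvd k * a"
      using b by (simp add: dvd_add_left_iff)
    then have "q dvd a"
      using assms(1,4) by (simp add: prime_dvd_mult_iff)
    then show False
      using b assms(1,3) not_coprimeI not_prime_unit by blast
  qed
qed

lemma prime_dvd_quartic_30_mod_5:
  fixes q a b :: int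
  assumes "prime q" "odd q" "coprime a b"
    and "q dvd a^4 + 5 * a^3 * b + 11 * a\<^sup>2 * b\<^sup>2 + 10 * a * b^3 + 4 * b^4"
  shows "q mod 5 \<in> {0, 1, 4}"
proof -
  \<comment> \<open>The quartic is the norm of \<open>(?u + ?v * \<surd>5) / 2\<close>.\<close>
  let ?u = "2 * a\<^sup>2 + 5 * a * b + 6 * b\<^sup>2" and ?v = "b * (a + 2 * b)"
  have "4 * (a^4 + 5 * a^3 * b + 11 * a\<^sup>2 * b\<^sup>2 + 10 * a * b^3 + 4 * b^4) = ?u\<^sup>2 - 5 * ?v\<^sup>2"
    by (simp add: algebra_simps power2_eq_square power3_eq_cube power4_eq_xxxx)
  then have norm: "q dvd ?u\<^sup>2 - 5 * ?v\<^sup>2"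
    using assms(4) by (metis dvd_mult)
  have q2: "\<not> q dvd 2"
    using assms(1,2) primes_dvd_imp_eq[of q 2] by auto
  have "\<not> q dvd ?v"
  proof
    assume v: "q dvd ?v"
    then have "q dvd 5 * ?v\<^sup>2"
      by (simp add: power2_eq_square)
    then have "q dvd ?u\<^sup>2"
      using norm dvd_add[of q "?u\<^sup>2 - 5 * ?v\<^sup>2" "5 * ?v\<^sup>2"] by simp
    then have u: "q dvd ?u"
      using assms(1) prime_dvd_power by blast
    have b: "q dvd b"
    proof (rule ccontr)
      assume "\<not> q dvd b"
      then have "q dvd a + 2 * b"
        using v assms(1) by (simp add: prime_dvd_mult_iff)
      \<comment> \<open>\<open>2 * a + b\<close> is the quotient of \<open>?u\<close> by
        \<open>a + 2 * b\<close>; the remainder \<open>4 * b^2\<close> is prime to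
        \<open>q\<close>.\<close>
      then have "q dvd ?u - (a + 2 * b) * (2 * a + b)"
        by (rule dvd_diff[OF u dvd_mult2])
      also have "?u - (a + 2 * b) * (2 * a + b) = 2 * 2 * b\<^sup>2"
        by (simp add: algebra_simps power2_eq_square)
      finally show False
        using q2 \<open>\<not> q dvd b\<close>
        by (auto simp only: prime_dvd_mult_iff[OF assms(1)] dest: prime_dvd_power[OF assms(1)])
    qed
    have "q dvd ?u - (5 * a + 6 * b) * b"
      by (rule dvd_diff[OF u dvd_mult[OF b]])
    also have "?u - (5 * a + 6 * b) * b = 2 * a\<^sup>2"
      by (simp add: algebra_simps power2_eq_square)
    finally have "q dvd a"
      using q2
      by (auto simp only: prime_dvd_mult_iff[OF assms(1)] dest: prime_dvd_power[OF assms(1)])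
    then show False
      using b assms(1,3) not_coprimeI not_prime_unit by blast
  qed
  then show ?thesis
    using prime_dvd_norm_sqrt5_mod_5 assms(1,2) norm by blast
qed

lemma prime_dvd_sextic_35_mod_5:
  fixes q a b :: int
  assumes "prime q" "odd q" "coprime a b"
    and "q dvd a^6 - 5 * a^5 * b - 9 * a^3 * b^3 - 5 * a * b^5 - b^6"
  shows "q mod 5 \<in> {0, 1, 4}"
proof (cases "q = 5")
  case False
  \<comment> \<open>The sextic is the norm of \<open>(?u + b * ?w * \<surd>5) / 2\<close>. The prime
    5 is set apart because the eliminations below leave multiples of 5.\<close>
  let ?u = "2 * a^3 - 5 * a\<^sup>2 * b + 5 * a * b\<^sup>2 - 4 * b^3" and ?w = "3 * a\<^sup>2 - a * b + 2 * b\<^sup>2"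
  have "4 * (a^6 - 5 * a^5 * b - 9 * a^3 * b^3 - 5 * a * b^5 - b^6) = ?u\<^sup>2 - 5 * (b * ?w)\<^sup>2"
    by (simp add: algebra_simps eval_nat_numeral)
  then have norm: "q dvd ?u\<^sup>2 - 5 * (b * ?w)\<^sup>2"
    using assms(4) by (metis dvd_mult)
  have q2: "\<not> q dvd 2" and q5: "\<not> q dvd 5"
    using False assms(1,2) primes_dvd_imp_eq[of q 2] primes_dvd_imp_eq[of q 5] by auto
  have "\<not> q dvd b * ?w"
  proof
    assume v: "q dvd b * ?w"
    then have "q dvd 5 * (b * ?w)\<^sup>2"
      by (simp add: power2_eq_square)
    then have "q dvd ?u\<^sup>2"
      using norm dvd_add[of q "?u\<^sup>2 - 5 * (b * ?w)\<^sup>2" "5 * (b * ?w)\<^sup>2"] by simp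
    then have u: "q dvd ?u"
      using assms(1) prime_dvd_power by blast
    have b: "q dvd b"
    proof (rule ccontr)
      assume nb: "\<not> q dvd b"
      then have w: "q dvd ?w"
        using v assms(1) by (simp add: prime_dvd_mult_iff)
      \<comment> \<open>Pseudo-division of \<open>?u\<close> by \<open>?w\<close> in the variable
        \<open>a\<close>; the 9 is the square of the leading coefficient of
        \<open>?w\<close>.\<close>
      have "q dvd 9 * ?u - (6 * a - 13 * b) * ?w"
        by (rule dvd_diff[OF dvd_mult[OF u] dvd_mult[OF w]])
      also have "9 * ?u - (6 * a - 13 * b) * ?w = 2 * (5 * (b\<^sup>2 * (2 * a - b)))"
        by (simp add: algebra_simps power2_eq_square power3_eq_cube)
      finally have root: "q dvd 2 * a - b"
        using q2 q5 nb
        by (auto simp only: prime_dvd_mult_iff[OF assms(1)] dest: prime_dvd_power[OF assms(1)])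
      \<comment> \<open>The cofactor is the quotient of \<open>?u\<close> by
        \<open>2 * a - b\<close> as polynomials in \<open>b\<close>, so that only a multiple of
        \<open>a^3\<close> remains.\<close>
      then have "q dvd (2 * a - b) * (4 * b\<^sup>2 + 3 * a * b + 11 * a\<^sup>2) - ?u"
        by (rule dvd_diff[OF dvd_mult2 u])
      also have "(2 * a - b) * (4 * b\<^sup>2 + 3 * a * b + 11 * a\<^sup>2) - ?u = 2 * (2 * (5 * a^3))"
        by (simp add: algebra_simps power2_eq_square power3_eq_cube)
      finally have "q dvd a"
        using q2 q5
        by (auto simp only: prime_dvd_mult_iff[OF assms(1)] dest: prime_dvd_power[OF assms(1)])
      then have "q dvd 2 * a - (2 * a - b)"
        by (rule dvd_diff[OF dvd_mult root])
      then show False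
        using nb by simp
    qed
    have "q dvd ?u - (- 5 * a\<^sup>2 + 5 * a * b - 4 * b\<^sup>2) * b"
      by (rule dvd_diff[OF u dvd_mult[OF b]])
    also have "?u - (- 5 * a\<^sup>2 + 5 * a * b - 4 * b\<^sup>2) * b = 2 * a^3"
      by (simp add: algebra_simps power2_eq_square power3_eq_cube)
    finally have "q dvd a"
      using q2
      by (auto simp only: prime_dvd_mult_iff[OF assms(1)] dest: prime_dvd_power[OF assms(1)])
    then show False
      using b assms(1,3) not_coprimeI not_prime_unit by blast
  qed
  then show ?thesis
    using prime_dvd_norm_sqrt5_mod_5 assms(1,2) norm by blast
qed simp

text \<open>Multiplicativity over the prime factors, each 1 or -1 modulo 5; squaring also absorbs
  the sign of \<open>r\<close>.\<close>

lemma square_cong_1_mod_5: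
  fixes r :: int
  assumes "r \<noteq> 0" "\<And>q. prime q \<Longrightarrow> q dvd r \<Longrightarrow> q mod 5 \<in> {1, 4}"
  shows "[r\<^sup>2 = 1] (mod 5)"
  using assms
proof (induction r rule: prime_divisors_induct)
  case (unit r)
  then show ?case
    by (auto simp: zdvd1_eq abs_if split: if_splits)
next
  case (factor p r)
  have "p mod 5 \<in> {1, 4}"
    using factor by simp
  then have "(p mod 5)\<^sup>2 mod 5 = 1"
    by auto
  then have "[p\<^sup>2 = 1] (mod 5)"
    by (simp add: cong_def power_mod)
  moreover have "[r\<^sup>2 = 1] (mod 5)"
    using factor by simp
  ultimately have "[p\<^sup>2 * r\<^sup>2 = 1 * 1] (mod 5)"
    by (rule cong_mult)
  then show ?case
    by (simp add: power_mult_distrib)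
qed simp

text \<open>The lists are the form on the residue discs modulo 5, first the disc at infinity. With a
  tail divisible by 5, respectively 25, the head alone decides the residue, respectively exact
  divisibility by 5.\<close>

definition values_test_5 :: "int list \<Rightarrow> bool" where
  "values_test_5 cs \<longleftrightarrow>
    list_all (\<lambda>ds. ds \<noteq> [] \<and> (hd ds mod 5 = 1 \<and> list_all ((dvd) 5) (tl ds) \<or>
        5 dvd hd ds \<and> \<not> 25 dvd hd ds \<and> list_all ((dvd) 25) (tl ds)))
      (form_subst 5 0 (rev cs) # map (\<lambda>x. form_subst 5 x cs) [0..4])"

lemma values_mod_5:
  assumes "values_test_5 cs" "length cs = 9" "coprime a b"
  shows "binary_form cs a b mod 5 = 1 \<or> 5 dvd binary_form cs a b \<and> \<not> 25 dvd binary_form cs a b"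
proof -
  have p5: "prime (5 :: int)"
    by simp
  have val: "binary_form ds x y mod 5 = 1 \<or> 5 dvd binary_form ds x y \<and> \<not> 25 dvd binary_form ds x y"
    if ds: "ds \<noteq> []" "length ds = 9" "\<not> 5 dvd y"
      and test: "hd ds mod 5 = 1 \<and> list_all ((dvd) 5) (tl ds) \<or>
        5 dvd hd ds \<and> \<not> 25 dvd hd ds \<and> list_all ((dvd) 25) (tl ds)" for ds and x y :: int
  proof -
    obtain c cs' where cs': "ds = c # cs'"
      using ds(1) by (cases ds) auto
    have F: "binary_form ds x y = c * y ^ 8 + x * binary_form cs' x y"
      using ds(2) by (simp add: cs')
    have "y mod 5 \<in> {1, 2, 3, 4}"
      using ds(3) by (auto simp: dvd_eq_mod_eq_0)
    \<comment> \<open>Fermat, as 4 divides the degree 8.\<close>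
    then have "(y mod 5) ^ 8 mod 5 = 1"
      by auto
    then have y: "y ^ 8 mod 5 = 1"
      by (simp add: power_mod)
    from test show ?thesis
    proof
      assume "hd ds mod 5 = 1 \<and> list_all ((dvd) 5) (tl ds)"
      then have c: "c mod 5 = 1" "5 dvd x * binary_form cs' x y"
        by (simp_all add: cs' dvd_binary_form)
      have "c * y ^ 8 mod 5 = 1"
        using c(1) y mod_mult_eq[of c 5 "y ^ 8"] by simp
      then have "binary_form ds x y mod 5 = 1"
        unfolding F using c(2) by (metis add.right_neutral dvd_imp_mod_0 mod_add_right_eq)
      then show ?thesis ..
    next
      assume "5 dvd hd ds \<and> \<not> 25 dvd hd ds \<and> list_all ((dvd) 25) (tl ds)"
      then have c: "5 dvd c" "\<not> 25 dvd c" "25 dvd x * binary_form cs' x y"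
        by (simp_all add: cs' dvd_binary_form)
      have "coprime 5 y"
        using ds(3) p5 prime_imp_coprime by blast
      then have "coprime 25 (y ^ 8)"
        using coprime_power_left_iff[of 5 2 "y ^ 8"] by simp
      then have "\<not> 25 dvd c * y ^ 8"
        using c(2) by (simp add: coprime_dvd_mult_left_iff)
      then have "\<not> 25 dvd binary_form ds x y"
        unfolding F using c(3) by (simp add: dvd_add_left_iff)
      moreover have "5 dvd x * binary_form cs' x y"
        by (rule dvd_trans[OF _ c(3)]) simp
      ultimately show ?thesis
        unfolding F using c(1) by simp
    qed
  qed
  show ?thesis
  proof (cases "5 dvd b")
    case False
    obtain x a' where x: "x \<in> {0..4}" "a = x * b + 5 * a'"
      using residue_quotient[OF p5 False, of a] by auto
    show ?thesis
      using val[of "form_subst 5 x cs" b a'] assms x False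
      by (simp add: values_test_5_def list_all_iff binary_form_subst)
  next
    case True
    then obtain b' where b': "b = 5 * b'"
      by (rule dvdE)
    have "\<not> 5 dvd a"
      using True p5 assms(3) not_coprimeI not_prime_unit by blast
    then show ?thesis
      using val[of "form_subst 5 0 (rev cs)" a b'] assms
      by (simp add: values_test_5_def binary_form_subst binary_form_rev b')
  qed
qed

text \<open>The factor \<open>s\<close> takes up the powers of 2, which the last hypothesis leaves
  out. A value divisible by 5 is not divisible by 25, so 5 does not divide \<open>r\<close>, and the
  prime factors of \<open>r\<close> are 1 or -1 modulo 5.\<close>

lemma mod_5_of_prime_factors:
  assumes "binary_form cs a b = D * (s * r)\<^sup>2" "[s\<^sup>2 = 1] (mod 5)" "r \<noteq> 0" "odd r"
    and "values_test_5 cs" "length cs = 9" "coprime a b"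
    and prime: "\<And>q. prime q \<Longrightarrow> odd q \<Longrightarrow> q dvd binary_form cs a b \<Longrightarrow> q mod 5 \<in> {0, 1, 4}"
  shows "[D = 0] (mod 5) \<or> [D = 1] (mod 5)"
proof -
  have p5: "prime (5 :: int)"
    by simp
  have F: "binary_form cs a b mod 5 = 1 \<or> 5 dvd binary_form cs a b \<and> \<not> 25 dvd binary_form cs a b"
    using values_mod_5 assms by blast
  have "\<not> 5 dvd r"
  proof
    assume "5 dvd r"
    then obtain r' where "r = 5 * r'"
      by (rule dvdE)
    then have "binary_form cs a b = 25 * (D * (s * r')\<^sup>2)"
      using assms(1) by (simp add: power2_eq_square)
    then have 25: "25 dvd binary_form cs a b"
      by (metis dvd_triv_left)
    then have "5 dvd binary_form cs a b"
      by (rule dvd_trans[rotated]) simp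
    then show False
      using F 25 by (simp add: dvd_eq_mod_eq_0)
  qed
  have "[r\<^sup>2 = 1] (mod 5)"
  proof (rule square_cong_1_mod_5[OF \<open>r \<noteq> 0\<close>])
    fix q :: int
    assume q: "prime q" "q dvd r"
    have "odd q"
      using q(2) \<open>odd r\<close> dvd_trans by blast
    moreover have "q dvd binary_form cs a b"
      unfolding assms(1) using q(2) by (simp add: power2_eq_square)
    ultimately have "q mod 5 \<in> {0, 1, 4}"
      using prime q(1) by blast
    moreover have "q mod 5 \<noteq> 0"
    proof
      assume "q mod 5 = 0"
      then have "5 dvd r"
        using q(2) by (meson dvd_eq_mod_eq_0 dvd_trans)
      then show False
        using \<open>\<not> 5 dvd r\<close> by blast
    qed
    ultimately show "q mod 5 \<in> {1, 4}"
      by blast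
  qed
  then have "[D * (s\<^sup>2 * r\<^sup>2) = D * (1 * 1)] (mod 5)"
    using assms(2) by (intro cong_scalar_left cong_mult)
  then have "[binary_form cs a b = D] (mod 5)"
    unfolding assms(1) by (simp add: power_mult_distrib)
  then show ?thesis
    using F unfolding cong_def by auto
qed

section \<open>The values of the hyperelliptic polynomials\<close>

text \<open>The extra factor \<open>b\<close> turns the exponent \<open>length cs - 1\<close> into
  \<open>length cs\<close>, so that the empty list is no exception.\<close>

lemma binary_form_eq_poly:
  fixes a b :: int
  assumes "b \<noteq> 0"
  shows "of_int (binary_form cs a b) * of_int b =
    poly (map_poly of_int (Poly cs)) (of_int a / of_int b :: rat) * of_int b ^ length cs"
proof (induction cs)
  case (Cons c cs)
  let ?P = "poly (map_poly of_int (Poly cs)) (of_int a / of_int b :: rat)"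
  have "of_int (binary_form (c # cs) a b) * (of_int b :: rat) =
      of_int c * of_int b ^ Suc (length cs) + of_int a * (of_int (binary_form cs a b) * of_int b)"
    by (simp add: algebra_simps)
  also have "\<dots> = (of_int c + of_int a / of_int b * ?P) * of_int b ^ Suc (length cs)"
    unfolding Cons.IH using assms by (simp add: field_simps)
  also have "\<dots> = poly (map_poly of_int (Poly (c # cs))) (of_int a / of_int b) * of_int b ^ length (c # cs)"
    by (simp add: map_poly_pCons)
  finally show ?case .
qed simp

text \<open>Odd length means even degree, so the power of the denominator is a square and is
  absorbed into \<open>r\<close>; squarefreeness of \<open>D\<close> makes the new root
  integral.\<close>

lemma squarefree_part_of_value:
  fixes x :: rat and f :: "int poly"
  assumes "poly (map_poly of_int f) x = of_int D * r\<^sup>2" "r \<noteq> 0" "squarefree D"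
    and "odd (length (coeffs f))"
  obtains a b s where "coprime a b" "binary_form (coeffs f) a b = D * s\<^sup>2" "s \<noteq> 0"
proof -
  obtain a b where ab: "x = of_int a / of_int b" "b > 0" "coprime a b"
    by (metis quotient_of_div quotient_of_denom_pos quotient_of_coprime surj_pair)
  obtain k where k: "length (coeffs f) = 2 * k + 1"
    using assms(4) by (rule oddE)
  let ?F = "binary_form (coeffs f) a b"
  have "of_int ?F * (of_int b :: rat) = of_int D * r\<^sup>2 * of_int b ^ (2 * k + 1)"
    using binary_form_eq_poly[of b "coeffs f" a] ab assms(1) k by simp
  also have "\<dots> = of_int D * (r * of_int b ^ k)\<^sup>2 * of_int b"
    by (simp add: power_mult_distrib power_mult[symmetric] mult.commute[of 2])
  finally have F: "of_int ?F = of_int D * (r * of_int b ^ k)\<^sup>2"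
    using ab(2) by simp
  then have "r * of_int b ^ k \<in> \<int>"
    using squarefree_mult_square_in_Ints[OF assms(3)] Ints_of_int by metis
  then obtain s where s: "r * of_int b ^ k = of_int s"
    by (rule Ints_cases)
  have "(of_int ?F :: rat) = of_int (D * s\<^sup>2)"
    using F s by simp
  then have "?F = D * s\<^sup>2"
    by (simp only: of_int_eq_iff)
  moreover have "s \<noteq> 0"
    using s assms(2) ab(2) by auto
  ultimately show thesis
    using that ab(3) by blast
qed

definition square_test :: "nat \<Rightarrow> bool \<Rightarrow> int list \<Rightarrow> bool" where
  "square_test p e cs \<longleftrightarrow>
    local_test (int p) (int p) (map (\<lambda>w. w * w mod int p) [1..int p div 2]) e cs"

locale represented_discriminant = quadratic_discriminant +
  fixes cs :: "int list" and a b r :: int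
  assumes odd_length: "odd (length cs)" and coprime: "coprime a b"
    and value_eq: "binary_form cs a b = D * r\<^sup>2" and r_nonzero: "r \<noteq> 0"
begin

lemma square_test_odd_prime:
  assumes "square_test p e cs" "prime p" "odd p"
  shows "\<exists>s. int p dvd s\<^sup>2 - D" "\<not> e \<Longrightarrow> \<not> int p dvd D"
proof -
  have "prime (int p)" "int p > 2"
    using assms(2,3) prime_ge_2_nat[of p] by (cases "p = 2"; simp)+
  then show "\<exists>s. int p dvd s\<^sup>2 - D" "\<not> e \<Longrightarrow> \<not> int p dvd D"
    using local_test_odd_prime[OF assms(1)[unfolded square_test_def] _ _ odd_length coprime
        squarefree value_eq r_nonzero] by blast+
qed

lemma not_inert_test: "square_test p e cs \<Longrightarrow> prime p \<Longrightarrow> odd p \<Longrightarrow> \<not> inert_in p K"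
  using square_test_odd_prime(1) not_inert_odd by blast

lemma splits_test: "square_test p False cs \<Longrightarrow> prime p \<Longrightarrow> odd p \<Longrightarrow> splits_in p K"
  using square_test_odd_prime splits_odd by blast

lemma test_2:
  assumes "local_test 2 q [1] e cs" "q \<in> {2, 4, 8}"
  shows "e \<and> even D \<or> [D = 1] (mod q)"
  using local_test_2[OF assms(1) _ _ _ odd_length coprime squarefree value_eq r_nonzero] assms(2)
  by auto

lemma odd_test:
  assumes "local_test 2 q [1] False cs" "q \<in> {2, 4, 8}"
  shows "odd D"
proof -
  have "[D = 1] (mod q)" "even q"
    using test_2[OF assms] assms(2) by auto
  then have "[D = 1] (mod 2)"
    using cong_dvd_modulus by blast
  then show ?thesis
    by (simp add: cong_def odd_iff_mod_2_eq_one)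
qed

lemma splits_2_test: "local_test 2 8 [1] False cs \<Longrightarrow> splits_in 2 K"
  using test_2[of 8 False] splits_2 by (simp add: cong_def)

lemma not_ramified_2_test: "local_test 2 4 [1] False cs \<Longrightarrow> \<not> ramified_in 2 K"
  using test_2[of 4 False] not_ramified_2 by (simp add: cong_def)

lemma mod_5_30:
  assumes cs: "cs = [16, 112, 316, 484, 441, 242, 79, 14, 1]" and test: "values_test_5 cs"
  shows "[D = 0] (mod 5) \<or> [D = 1] (mod 5)"
proof -
  \<comment> \<open>The form is \<open>(a^2 + 3 a b + b^2) (a^2 + 6 a b + 4 b^2)\<close> times the
    quartic; completing the square in the first factor costs the 4.\<close>
  have factor: "4 * binary_form cs a b = ((2 * a + 3 * b)\<^sup>2 - 5 * b\<^sup>2) * (((1 * a + 3 * b)\<^sup>2 - 5 * b\<^sup>2) *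
      (a^4 + 5 * a^3 * b + 11 * a\<^sup>2 * b\<^sup>2 + 10 * a * b^3 + 4 * b^4))"
    unfolding cs by (simp add: algebra_simps eval_nat_numeral)
  have prime: "q mod 5 \<in> {0, 1, 4}" if q: "prime q" "odd q" "q dvd binary_form cs a b" for q
  proof -
    have q12: "\<not> q dvd 1" "\<not> q dvd 2"
      using q(1,2) primes_dvd_imp_eq[of q 2] not_prime_unit by auto
    have "q dvd 4 * binary_form cs a b"
      using q(3) by (rule dvd_mult)
    then consider "q dvd (2 * a + 3 * b)\<^sup>2 - 5 * b\<^sup>2" | "q dvd (1 * a + 3 * b)\<^sup>2 - 5 * b\<^sup>2"
      | "q dvd a^4 + 5 * a^3 * b + 11 * a\<^sup>2 * b\<^sup>2 + 10 * a * b^3 + 4 * b^4"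
      unfolding factor by (auto simp only: prime_dvd_mult_iff[OF q(1)])
    then show ?thesis
      using q coprime q12 prime_dvd_quadratic_norm_mod_5 prime_dvd_quartic_30_mod_5 by cases blast+
  qed
  show ?thesis
  proof (cases "even r")
    case False
    then show ?thesis
      using mod_5_of_prime_factors[of cs a b D 1 r] value_eq r_nonzero test cs coprime prime by simp
  next
    case True
    then have "even (binary_form cs a b)"
      unfolding value_eq by simp
    then have "even a"
      by (auto simp: cs)
    then obtain c where c: "a = 2 * c"
      by (rule evenE)
    have "odd b"
      using \<open>even a\<close> coprime by (metis coprime_common_divisor odd_one)
    \<comment> \<open>The value at \<open>a = 2 * c\<close> is \<open>16 * G\<close>. For odd
      \<open>b\<close> the terms in \<open>c^2\<close> and \<open>c^4\<close> have equal parity and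
      \<open>b^8\<close> is odd, so \<open>G\<close> is odd. Removing 4 twice against the squarefree
      \<open>D\<close> gives \<open>r = 4 * w\<close> with \<open>w\<close> odd, and
      \<open>4^2\<close> is 1 modulo 5.\<close>
    define G where "G = b^8 + 14 * c * b^7 + 79 * c\<^sup>2 * b^6 + 242 * c^3 * b^5 + 441 * c^4 * b^4
      + 484 * c^5 * b^3 + 316 * c^6 * b\<^sup>2 + 112 * c^7 * b + 16 * c^8"
    have "odd G"
      unfolding G_def using \<open>odd b\<close> by simp
    have "binary_form cs a b = 2 * 2 * (2 * 2 * G)"
      unfolding cs c G_def by (simp add: algebra_simps eval_nat_numeral)
    then have G: "D * r\<^sup>2 = 2 * 2 * (2 * 2 * G)"
      using value_eq by simp
    obtain s where s: "r = 2 * s"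
      using True by (rule evenE)
    have Ds: "D * s\<^sup>2 = 2 * 2 * G"
      using G by (simp add: s power_mult_distrib)
    then have "even s"
      using squarefree_prime_square_dvd[OF two_is_prime(1) squarefree, of s] by simp
    then obtain w where w: "s = 2 * w"
      by (rule evenE)
    have "D * w\<^sup>2 = G"
      using Ds by (simp add: w power_mult_distrib)
    then have "odd w"
      using \<open>odd G\<close> by auto
    moreover have "[4\<^sup>2 = 1 :: int] (mod 5)"
      by (simp add: cong_def)
    moreover have "binary_form cs a b = D * (4 * w)\<^sup>2" "w \<noteq> 0"
      using value_eq r_nonzero by (simp_all add: s w)
    ultimately show ?thesis
      using mod_5_of_prime_factors[of cs a b D 4 w] test cs coprime prime by simp
  qed
qed

lemma mod_5_35:
  assumes cs: "cs = [1, 4, -6, 4, -9, -4, -6, -4, 1]" and test: "values_test_5 cs"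
  shows "[D = 0] (mod 5) \<or> [D = 1] (mod 5)"
proof -
  \<comment> \<open>The form is \<open>a^2 + a b - b^2\<close> times the sextic; the 4 completes the
    square.\<close>
  have factor: "4 * binary_form cs a b = ((2 * a + 1 * b)\<^sup>2 - 5 * b\<^sup>2) *
      (a^6 - 5 * a^5 * b - 9 * a^3 * b^3 - 5 * a * b^5 - b^6)"
    unfolding cs by (simp add: algebra_simps eval_nat_numeral)
  have prime: "q mod 5 \<in> {0, 1, 4}" if q: "prime q" "odd q" "q dvd binary_form cs a b" for q
  proof -
    have q2: "\<not> q dvd 2"
      using q(1,2) primes_dvd_imp_eq[of q 2] by auto
    have "q dvd 4 * binary_form cs a b"
      using q(3) by (rule dvd_mult)
    then consider "q dvd (2 * a + 1 * b)\<^sup>2 - 5 * b\<^sup>2"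
      | "q dvd a^6 - 5 * a^5 * b - 9 * a^3 * b^3 - 5 * a * b^5 - b^6"
      unfolding factor by (auto simp only: prime_dvd_mult_iff[OF q(1)])
    then show ?thesis
      using q coprime q2 prime_dvd_quadratic_norm_mod_5 prime_dvd_sextic_35_mod_5 by cases blast+
  qed
  have "odd a \<or> odd b"
    using coprime by (metis coprime_common_divisor odd_one)
  \<comment> \<open>Modulo 2 the form is \<open>a^8 + a^4 b^4 + b^8\<close>, even only if both
    arguments are. Hence no power of 2 has to be split off \<open>r\<close>.\<close>
  then have "odd (binary_form cs a b)"
    by (auto simp add: cs)
  then have "odd r"
    unfolding value_eq by auto
  then show ?thesis
    using mod_5_of_prime_factors[of cs a b D 1 r] value_eq r_nonzero test cs coprime prime by simp
qed

end

section \<open>Computations for the individual models\<close>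

lemma model_tests:
  "list_all (\<lambda>N. odd (length (coeffs (fN N)))) [22, 26, 28, 29, 30, 33, 35, 39, 40, 41, 46, 48, 50]"
  "values_test_5 (coeffs (fN 30))"
  "values_test_5 (coeffs (fN 35))"
  "coeffs (fN 30) = [16, 112, 316, 484, 441, 242, 79, 14, 1]"
  "coeffs (fN 35) = [1, 4, -6, 4, -9, -4, -6, -4, 1]"
  by code_simp+

text \<open>Certificates as sums of squares with positive weights; they make \<open>D\<close>
  positive for these \<open>N\<close>.\<close>

lemma nonneg_values:
  fixes x :: rat
  assumes "N \<in> {28, 33, 40, 48}"
  shows "fN_eval N x \<ge> 0"
proof -
  have cs: "coeffs (fN 28) = [4, -12, 25, -30, 25, -12, 4]"
    "coeffs (fN 33) = [33, -44, 82, -40, 47, -8, 10, 0, 1]"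
    "coeffs (fN 40) = [1, 0, 8, 0, -2, 0, 8, 0, 1]"
    "coeffs (fN 48) = [1, 0, 0, 0, 14, 0, 0, 0, 1]"
    by code_simp+
  have eval: "fN_eval M x = poly (map_poly of_int (Poly (coeffs (fN M)))) x" for M
    by simp
  have "fN_eval 28 x = (2 * x^3 - 3 * x\<^sup>2 + 3 * x - 2)\<^sup>2 + x\<^sup>2 * ((2 * x - 1)\<^sup>2 + 3)"
    unfolding eval cs by (simp add: map_poly_pCons algebra_simps eval_nat_numeral)
  \<comment> \<open>\<open>11 / 2\<close> is the constant for which the linear terms agree; what
    remains is even in \<open>x\<close> with positive coefficients.\<close>
  moreover have "fN_eval 33 x = (x^4 + 5 * x\<^sup>2 - 4 * x + 11 / 2)\<^sup>2 + 11 * (x\<^sup>2)\<^sup>2 + 11 * x\<^sup>2 + 11 / 4"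
    unfolding eval cs by (simp add: map_poly_pCons field_simps eval_nat_numeral)
  moreover have "fN_eval 40 x = (x^4 - 1)\<^sup>2 + 8 * (x^3)\<^sup>2 + 8 * x\<^sup>2"
    unfolding eval cs by (simp add: map_poly_pCons algebra_simps eval_nat_numeral)
  moreover have "fN_eval 48 x = (x^4)\<^sup>2 + 14 * (x\<^sup>2)\<^sup>2 + 1"
    unfolding eval cs by (simp add: map_poly_pCons algebra_simps eval_nat_numeral)
  ultimately show ?thesis
    using assms by (auto intro!: add_nonneg_nonneg mult_nonneg_nonneg)
qed

lemma model_square_tests:
  "square_test 13 True (coeffs (fN 26))"
  "square_test 7 True (coeffs (fN 28))"
  "square_test 3 False (coeffs (fN 28))"
  "square_test 29 True (coeffs (fN 29))"
  "square_test 3 False (coeffs (fN 30))"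
  "square_test 5 True (coeffs (fN 30))"
  "square_test 11 True (coeffs (fN 33))"
  "square_test 5 True (coeffs (fN 35))"
  "square_test 7 False (coeffs (fN 35))"
  "square_test 3 True (coeffs (fN 39))"
  "square_test 13 False (coeffs (fN 39))"
  "square_test 3 False (coeffs (fN 40))"
  "square_test 5 False (coeffs (fN 40))"
  "square_test 41 True (coeffs (fN 41))"
  "square_test 3 False (coeffs (fN 48))"
  "square_test 5 False (coeffs (fN 48))"
  "square_test 5 True (coeffs (fN 50))"
  by code_simp+

text \<open>The modulus is 8 for splitting at 2 and for \<open>N = 22\<close>, 4 for being
  unramified at 2, and 2 for mere oddness of \<open>D\<close>.\<close>

lemma model_tests_2:
  "local_test 2 8 [1] True (coeffs (fN 22))"
  "local_test 2 2 [1] False (coeffs (fN 26))"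
  "local_test 2 2 [1] False (coeffs (fN 29))"
  "local_test 2 8 [1] False (coeffs (fN 30))"
  "local_test 2 8 [1] False (coeffs (fN 33))"
  "local_test 2 4 [1] False (coeffs (fN 35))"
  "local_test 2 4 [1] False (coeffs (fN 39))"
  "local_test 2 8 [1] False (coeffs (fN 40))"
  "local_test 2 8 [1] False (coeffs (fN 46))"
  "local_test 2 8 [1] False (coeffs (fN 48))"
  "local_test 2 2 [1] False (coeffs (fN 50))"
  by code_simp+

theorem theorem2p2:
  fixes N :: nat and X Y :: "complex \<Rightarrow> complex"
    and x0 :: rat and y0 :: complex and D :: int and K :: "complex set"
  assumes N: "N \<in> {22, 26, 28, 29, 30, 33, 35, 39, 40, 41, 46, 48, 50}"
    and model: "X0_model N X Y"
    and nonsquare: "\<nexists>r :: rat. fN_eval N x0 = r\<^sup>2"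
    and point: "y0\<^sup>2 = of_rat (fN_eval N x0)"
    and noncuspidal: "\<not> is_cusp X Y (of_rat x0, y0)"
    and D: "squarefree D" "\<exists>r :: rat. r \<noteq> 0 \<and> fN_eval N x0 = of_int D * r\<^sup>2"
    and K: "K = quadratic_field D"
  shows "(N = 22 \<longrightarrow> ([D = 1] (mod 8) \<or> [D = 2] (mod 8) \<or> [D = 6] (mod 8)) \<and> \<not> inert_in 2 K) \<and>
         (N = 26 \<longrightarrow> \<not> inert_in 13 K \<and> odd D) \<and>
         (N = 28 \<longrightarrow> \<not> inert_in 7 K \<and> splits_in 3 K \<and> D > 0) \<and>
         (N = 29 \<longrightarrow> \<not> inert_in 29 K \<and> odd D) \<and>
         (N = 30 \<longrightarrow> splits_in 2 K \<and> splits_in 3 K \<and>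
            ([D = 0] (mod 5) \<or> [D = 1] (mod 5)) \<and> \<not> inert_in 5 K \<and> odd D) \<and>
         (N = 33 \<longrightarrow> splits_in 2 K \<and> \<not> inert_in 11 K \<and> odd D \<and> D > 0) \<and>
         (N = 35 \<longrightarrow> ([D = 0] (mod 5) \<or> [D = 1] (mod 5)) \<and> \<not> inert_in 5 K \<and>
            \<not> ramified_in 2 K \<and> splits_in 7 K \<and> odd D) \<and>
         (N = 39 \<longrightarrow> \<not> inert_in 3 K \<and> \<not> ramified_in 2 K \<and> splits_in 13 K \<and> odd D) \<and>
         (N = 40 \<longrightarrow> splits_in 2 K \<and> splits_in 3 K \<and> splits_in 5 K \<and> odd D \<and> D > 0) \<and>
         (N = 41 \<longrightarrow> \<not> inert_in 41 K) \<and>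
         (N = 46 \<longrightarrow> splits_in 2 K \<and> odd D) \<and>
         (N = 48 \<longrightarrow> splits_in 2 K \<and> splits_in 3 K \<and> splits_in 5 K \<and> odd D \<and> D > 0) \<and>
         (N = 50 \<longrightarrow> \<not> inert_in 5 K \<and> odd D)"
proof -
  obtain r where r: "r \<noteq> 0" "fN_eval N x0 = of_int D * r\<^sup>2"
    using D(2) by blast
  have len: "odd (length (coeffs (fN N)))"
    using N model_tests(1) by (auto simp: list_all_iff)
  obtain a b s where abs: "coprime a b" "binary_form (coeffs (fN N)) a b = D * s\<^sup>2" "s \<noteq> 0"
    using squarefree_part_of_value[OF r(2,1) D(1) len] .
  interpret represented_discriminant D K "coeffs (fN N)" a b s
  proof
    \<comment> \<open>If \<open>D\<close> were \<open>t^2\<close>, the value would be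
      \<open>(t * r)^2\<close>.\<close>
    show "\<nexists>t :: rat. of_int D = t\<^sup>2"
      using nonsquare r(2) by (metis power_mult_distrib)
  qed (use D(1) K len abs in auto)
  have pos: "D > 0" if "N \<in> {28, 33, 40, 48}"
  proof -
    have "of_int D * r\<^sup>2 \<ge> 0"
      using nonneg_values[OF that, of x0] r(2) by simp
    then have "D \<ge> 0"
      using r(1) by (simp add: zero_le_mult_iff)
    moreover have "D \<noteq> 0"
      using D(1) by auto
    ultimately show ?thesis
      by simp
  qed
  \<comment> \<open>The search for \<open>N = 22\<close> accepts odd valuation at 2; an even
    squarefree \<open>D\<close> is 2 modulo 4, hence 2 or 6 modulo 8.\<close>
  have "[D = 1] (mod 8) \<or> even D" if "N = 22"
    using test_2[of 8 True] model_tests_2(1) that by auto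
  moreover have "[D = 2] (mod 8) \<or> [D = 6] (mod 8)" if "even D"
  proof -
    have "D mod 8 = 2 \<or> D mod 8 = 6"
      using that squarefree_mod_4_neq_0[OF D(1)] by presburger
    then show ?thesis
      by (simp add: cong_def)
  qed
  ultimately have "([D = 1] (mod 8) \<or> [D = 2] (mod 8) \<or> [D = 6] (mod 8)) \<and> \<not> inert_in 2 K" if "N = 22"
    using that not_inert_2 by (auto simp: cong_def)
  moreover have "\<not> inert_in 13 K" "odd D" if "N = 26"
    using that not_inert_test[of 13 True] odd_test[of 2] model_square_tests model_tests_2 by simp_all
  moreover have "\<not> inert_in 7 K" "splits_in 3 K" if "N = 28"
    using that not_inert_test[of 7 True] splits_test[of 3] model_square_tests by simp_all
  moreover have "\<not> inert_in 29 K" "odd D" if "N = 29"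
    using that not_inert_test[of 29 True] odd_test[of 2] model_square_tests model_tests_2 by simp_all
  moreover have "splits_in 2 K" "splits_in 3 K" "\<not> inert_in 5 K" "odd D"
      "[D = 0] (mod 5) \<or> [D = 1] (mod 5)" if "N = 30"
    using that splits_2_test splits_test[of 3] not_inert_test[of 5 True] odd_test[of 8] mod_5_30
      model_square_tests model_tests_2 model_tests by simp_all
  moreover have "splits_in 2 K" "\<not> inert_in 11 K" "odd D" if "N = 33"
    using that splits_2_test not_inert_test[of 11 True] odd_test[of 8]
      model_square_tests model_tests_2 by simp_all
  moreover have "\<not> inert_in 5 K" "\<not> ramified_in 2 K" "splits_in 7 K" "odd D"
      "[D = 0] (mod 5) \<or> [D = 1] (mod 5)" if "N = 35"
    using that not_ramified_2_test splits_test[of 7] not_inert_test[of 5 True] odd_test[of 4] mod_5_35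
      model_square_tests model_tests_2 model_tests by simp_all
  moreover have "\<not> inert_in 3 K" "\<not> ramified_in 2 K" "splits_in 13 K" "odd D" if "N = 39"
    using that not_ramified_2_test splits_test[of 13] not_inert_test[of 3 True] odd_test[of 4]
      model_square_tests model_tests_2 by simp_all
  moreover have "splits_in 2 K" "splits_in 3 K" "splits_in 5 K" "odd D" if "N = 40 \<or> N = 48"
    using that splits_2_test splits_test[of 3] splits_test[of 5] odd_test[of 8]
      model_square_tests model_tests_2 by auto
  moreover have "\<not> inert_in 41 K" if "N = 41"
    using that not_inert_test[of 41 True] model_square_tests by simp
  moreover have "splits_in 2 K" "odd D" if "N = 46"
    using that splits_2_test odd_test[of 8] model_tests_2 by simp_all
  moreover have "\<not> inert_in 5 K" "odd D" if "N = 50"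
    using that not_inert_test[of 5 True] odd_test[of 2] model_square_tests model_tests_2 by simp_all
  ultimately show ?thesis
    using pos by (intro conjI impI) simp_all
qed

end
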